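(* Let $\beta>0$, let $\mathbf{s}_j=(x'_j,y'_j)$, $j=1,\dots,N_S$, and $\mathbf{t}_l=(x_l,y_l)$, $l=1,\dots,N_T$, be sources and targets in the unit cell $\mathcal{C}$, and let $\mathbf{P}_2^{north}$ be the $N_T\times N_S$ matrix with entries $\mathbf{P}_2^{north}(l,j)=K_2^{north}(\mathbf{t}_l,\mathbf{s}_j)$. Given a precision $0<\epsilon<1$, let $$M=\left\lceil\frac{d}{2\pi\eta}\log\left(\frac{1}{1-e^{-2\pi\eta/d}}\,\frac1\epsilon\right)\right\rceil ,$$ and for $m=-M,\dots,M$ let $\alpha_m=\frac{2\pi m}{d}$, $\chi_m=\sqrt{\alpha_m^2+\beta^2}$, $Q_m=\chi_m\eta-i\alpha_m\xi$. Then $$\mathbf{P}_2^{north}=\mathbf{L}^{north}\,\mathbf{D}^{north}\,\mathbf{R}^{north}+O(\epsilon),$$ where $\mathbf{L}^{north}\in\mathbb{C}^{N_T\times(2M+1)}$, $\mathbf{R}^{north}\in\mathbb{C}^{(2M+1)\times N_S}$ and $\mathbf{D}^{north}=\overline{\mathbf{D}^{south}}$ (diagonal) are given by $$\mathbf{L}^{north}(l,m)=e^{\chi_m y_l}e^{i\alpha_m x_l},\quad \mathbf{R}^{north}(m,j)=e^{-\chi_m y'_j}e^{-i\alpha_m x'_j},\quad \mathbf{D}^{south}(m,m)=\frac{1}{2d\,\chi_m}\,\frac{e^{-2Q_m}}{1-e^{-Q_m}}.$$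
   Context: Let $d,\eta>0$ and $\xi\in\mathbb{R}$ with $d\ge\sqrt{\xi^2+\eta^2}$, $\mathbf{e}_1=(d,0)$, $\mathbf{e}_2=(\xi,\eta)$, $\mathcal{C}=\{x_1\mathbf{e}_1+x_2\mathbf{e}_2 : x_1,x_2\in[-\tfrac12,\tfrac12]\}$, $\mathbf{l}_{mn}=m\mathbf{e}_1+n\mathbf{e}_2$. $G(\mathbf{t},\mathbf{s})=\frac{1}{2\pi}K_0(\beta\|\mathbf{t}-\mathbf{s}\|)$ is the modified Helmholtz Green's function ($K_0$ the modified Bessel function of the second kind), and $$K_2^{north}(\mathbf{t},\mathbf{s})=\sum_{n=2}^{\infty}\sum_{m=-\infty}^{\infty}G(\mathbf{t},\mathbf{s}+\mathbf{l}_{mn}).$$ $O(\epsilon)$ denotes a matrix all of whose entries are bounded in absolute value by $C\epsilon$, where $C$ is independent of $\epsilon$ and of the number and locations of sources and targets ($C$ may depend on $d,\xi,\eta,\beta$). The bar denotes complex conjugation. Rows/columns indexed by $m$ run over $-M,\dots,M$. *)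

theory Defs
  imports
    "HOL-Analysis.Analysis"
    "Jordan_Normal_Form.Matrix"
begin

(* Modified Bessel function of the second kind of real order nu, at x > 0, by its standard
   integral representation (Schlaefli's integral, Watson 6.22(5), DLMF 10.32.9).
   For x <= 0 the integrand is not integrable and the value is irrelevant. *)
definition bessel_K :: "real \<Rightarrow> real \<Rightarrow> real" where
  "bessel_K \<nu> x = (LINT u:{0..}|lborel. exp (- x * cosh u) * cosh (\<nu> * u))"

definition green :: "real \<Rightarrow> real \<times> real \<Rightarrow> real \<times> real \<Rightarrow> real" where
  "green \<beta> t s = 1 / (2 * pi) * bessel_K 0 (\<beta> * norm (t - s))"

definition vec_e1 :: "real \<Rightarrow> real \<times> real" where
  "vec_e1 d = (d, 0)"

definition vec_e2 :: "real \<Rightarrow> real \<Rightarrow> real \<times> real" where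
  "vec_e2 \<xi> \<eta> = (\<xi>, \<eta>)"

definition unit_cell :: "real \<Rightarrow> real \<Rightarrow> real \<Rightarrow> (real \<times> real) set" where
  "unit_cell d \<xi> \<eta> =
     {x1 *\<^sub>R vec_e1 d + x2 *\<^sub>R vec_e2 \<xi> \<eta> | x1 x2. x1 \<in> {-1/2..1/2} \<and> x2 \<in> {-1/2..1/2}}"

definition lattice_vec :: "real \<Rightarrow> real \<Rightarrow> real \<Rightarrow> int \<Rightarrow> int \<Rightarrow> real \<times> real" where
  "lattice_vec d \<xi> \<eta> m n = of_int m *\<^sub>R vec_e1 d + of_int n *\<^sub>R vec_e2 \<xi> \<eta>"

definition K2_north ::
  "real \<Rightarrow> real \<Rightarrow> real \<Rightarrow> real \<Rightarrow> real \<times> real \<Rightarrow> real \<times> real \<Rightarrow> real" where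
  "K2_north d \<xi> \<eta> \<beta> t s =
     (\<Sum>\<^sub>\<infinity>n\<in>{2::int..}. \<Sum>\<^sub>\<infinity>m\<in>(UNIV::int set). green \<beta> t (s + lattice_vec d \<xi> \<eta> m n))"

definition trunc_order :: "real \<Rightarrow> real \<Rightarrow> real \<Rightarrow> nat" where
  "trunc_order d \<eta> \<epsilon> =
     nat \<lceil>d / (2 * pi * \<eta>) * ln (1 / (1 - exp (- 2 * pi * \<eta> / d)) * (1 / \<epsilon>))\<rceil>"

definition alpha_mode :: "real \<Rightarrow> int \<Rightarrow> real" where
  "alpha_mode d m = 2 * pi * of_int m / d"

definition chi_mode :: "real \<Rightarrow> real \<Rightarrow> int \<Rightarrow> real" where
  "chi_mode d \<beta> m = sqrt ((alpha_mode d m)\<^sup>2 + \<beta>\<^sup>2)"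

definition Q_mode :: "real \<Rightarrow> real \<Rightarrow> real \<Rightarrow> real \<Rightarrow> int \<Rightarrow> complex" where
  "Q_mode d \<xi> \<eta> \<beta> m =
     complex_of_real (chi_mode d \<beta> m * \<eta>) - \<i> * complex_of_real (alpha_mode d m * \<xi>)"

(* Matrices are indexed from 0: the point with index l (for l < N) belongs to row or column l,
   and the mode m in {-M..M} to row or column m + M. *)
definition mode :: "nat \<Rightarrow> nat \<Rightarrow> int" where
  "mode M k = int k - int M"

definition P2_north ::
  "real \<Rightarrow> real \<Rightarrow> real \<Rightarrow> real \<Rightarrow> nat \<Rightarrow> nat \<Rightarrow> (nat \<Rightarrow> real \<times> real) \<Rightarrow> (nat \<Rightarrow> real \<times> real) \<Rightarrow> complex mat" where
  "P2_north d \<xi> \<eta> \<beta> NT NS t s =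
     Matrix.mat NT NS (\<lambda>(l, j). complex_of_real (K2_north d \<xi> \<eta> \<beta> (t l) (s j)))"

definition L_north ::
  "real \<Rightarrow> real \<Rightarrow> nat \<Rightarrow> nat \<Rightarrow> (nat \<Rightarrow> real \<times> real) \<Rightarrow> complex mat" where
  "L_north d \<beta> M NT t =
     Matrix.mat NT (2 * M + 1) (\<lambda>(l, k). let m = mode M k; (x, y) = t l in
       exp (complex_of_real (chi_mode d \<beta> m * y)) * exp (\<i> * complex_of_real (alpha_mode d m * x)))"

definition R_north ::
  "real \<Rightarrow> real \<Rightarrow> nat \<Rightarrow> nat \<Rightarrow> (nat \<Rightarrow> real \<times> real) \<Rightarrow> complex mat" where
  "R_north d \<beta> M NS s =
     Matrix.mat (2 * M + 1) NS (\<lambda>(k, j). let m = mode M k; (x, y) = s j in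
       exp (- complex_of_real (chi_mode d \<beta> m * y)) * exp (- \<i> * complex_of_real (alpha_mode d m * x)))"

definition D_south :: "real \<Rightarrow> real \<Rightarrow> real \<Rightarrow> real \<Rightarrow> nat \<Rightarrow> complex mat" where
  "D_south d \<xi> \<eta> \<beta> M =
     Matrix.mat (2 * M + 1) (2 * M + 1) (\<lambda>(k, k'). if k = k' then
       (let m = mode M k; Q = Q_mode d \<xi> \<eta> \<beta> m in
         1 / complex_of_real (2 * d * chi_mode d \<beta> m) * (exp (- 2 * Q) / (1 - exp (- Q))))
       else 0)"

definition D_north :: "real \<Rightarrow> real \<Rightarrow> real \<Rightarrow> real \<Rightarrow> nat \<Rightarrow> complex mat" where
  "D_north d \<xi> \<eta> \<beta> M = map_mat cnj (D_south d \<xi> \<eta> \<beta> M)"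

end

theory Submission
  imports Defs "HOL-Probability.Characteristic_Functions"
begin

text \<open>
  Writing \<open>K\<^sub>0(\<beta> r)\<close> as a superposition \<open>1/2 \<integral> exp (- \<beta>\<^sup>2 e\<^sup>v - r\<^sup>2 e\<^sup>-\<^sup>v / 4) dv\<close> of Gaussians in \<open>r\<close>,
  the sum of the Green's function over a row of the lattice becomes an integral of Gaussian theta
  series.  Poisson summation inside the integral turns it into the absolutely convergent mode
  expansion with coefficients \<open>e\<^bsup>-\<chi> Y\<^esup> / (2 d \<chi>)\<close>, where \<open>Y\<close> is the vertical distance to the row.
  As \<open>Y = n \<eta> - (y - y') \<ge> \<eta>\<close> for \<open>n \<ge> 2\<close>, the sum over the rows is geometric in each mode, which
  yields the diagonal entries, and the mode \<open>m\<close> is of size \<open>O(e\<^bsup>-2\<pi>\<eta>\<bar>m\<bar>/d\<^esup>)\<close> uniformly in the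
  points; \<open>M\<close> is chosen such that the tail of this geometric series is \<open>O(\<epsilon>)\<close>.
\<close>

section \<open>Fourier series and Poisson summation\<close>

text \<open>The parameter \<open>v\<close> decouples what the Bessel function ties together. For
  fixed \<open>v\<close> the squared distance occurs only in a Gaussian, which splits into a
  horizontal and a vertical factor. Poisson summation in the horizontal factor produces
  \<open>\<alpha>\<^sup>2 exp v\<close>, which joins \<open>\<beta>\<^sup>2 exp v\<close> to give
  \<open>\<chi>\<^sup>2 exp v\<close>; this is the origin of \<open>chi_mode\<close>. The main
  obstacle is exchanging the \<open>v\<close>-integral with both series. The conjugate in
  \<open>D_north\<close> is a matter of phase: moving the source up by \<open>n\<close> rows also
  moves it by \<open>n * \<xi>\<close> sideways, which multiplies mode \<open>m\<close> by exp(-i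
  \<alpha> n \<xi>), so that row \<open>n\<close> carries the \<open>n\<close>-th power of exp(-cnj
  Q). The bound \<open>n \<ge> 2\<close> matters because for \<open>n = 1\<close> the vertical
  distance can be zero, and the decay in \<open>m\<close> is lost. The factor 1/(1 - exp(-2 pi
  \<eta>/d)) inside the logarithm of M cancels the sum of the geometric tail. What remains in the
  constant comes from 1/\<chi> \<le> 1/\<beta> and from the distance of exp(-cnj Q) to 1, both
  controlled by \<beta> > 0 even at \<open>m = 0\<close>.\<close>

lemma has_sum_integral:
  fixes f :: "'i \<Rightarrow> 'a \<Rightarrow> 'b::{banach, second_countable_topology}"
  assumes I: "countable I" "infinite I"
    and int: "\<And>i. i \<in> I \<Longrightarrow> integrable M (f i)"
    and sum: "(\<lambda>i. \<integral>x. norm (f i x) \<partial>M) summable_on I"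
    and abs: "\<And>x. x \<in> space M \<Longrightarrow> (\<lambda>i. norm (f i x)) summable_on I"
  shows "integrable M (\<lambda>x. \<Sum>\<^sub>\<infinity>i\<in>I. f i x)"
    and "((\<lambda>i. \<integral>x. f i x \<partial>M) has_sum (\<integral>x. (\<Sum>\<^sub>\<infinity>i\<in>I. f i x) \<partial>M)) I"
proof -
  \<comment> \<open>An infinite countable \<open>I\<close> is in bijection with the naturals, which
    carries the statement over to series indexed by \<open>nat\<close>.\<close>
  define e where "e = from_nat_into I"
  have e: "bij_betw e UNIV I"
    unfolding e_def using bij_betw_from_nat_into[OF I] .
  have eI: "e n \<in> I" for n using e by (auto simp: bij_betw_def)
  have 1: "integrable M (f (e n))" for n by (intro int eI)
  have 2: "AE x in M. summable (\<lambda>n. norm (f (e n) x))"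
  proof (rule AE_I2)
    fix x assume "x \<in> space M"
    from abs[OF this] have "(\<lambda>n. norm (f (e n) x)) summable_on UNIV"
      using summable_on_reindex_bij_betw[OF e, of "\<lambda>i. norm (f i x)"] by simp
    thus "summable (\<lambda>n. norm (f (e n) x))" by (rule summable_on_imp_summable)
  qed
  have 3: "summable (\<lambda>n. \<integral>x. norm (f (e n) x) \<partial>M)"
    using summable_on_reindex_bij_betw[OF e, of "\<lambda>i. \<integral>x. norm (f i x) \<partial>M"] sum
    by (intro summable_on_imp_summable) simp
  have S: "(\<Sum>\<^sub>\<infinity>i\<in>I. f i x) = (\<Sum>n. f (e n) x)" if "x \<in> space M" for x
  proof -
    have "((\<lambda>n. f (e n) x) has_sum (\<Sum>\<^sub>\<infinity>i\<in>I. f i x)) UNIV"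
      using has_sum_infsum[OF abs_summable_summable[OF abs[OF that]]]
        has_sum_reindex_bij_betw[OF e, of "\<lambda>i. f i x"] by simp
    from has_sum_imp_sums[OF this] show ?thesis by (rule sums_unique)
  qed
  show "integrable M (\<lambda>x. \<Sum>\<^sub>\<infinity>i\<in>I. f i x)"
    using integrable_suminf[OF 1 2 3] S by (subst Bochner_Integration.integrable_cong[OF refl S]) auto
  have *: "(\<integral>x. (\<Sum>\<^sub>\<infinity>i\<in>I. f i x) \<partial>M) = (\<Sum>n. \<integral>x. f (e n) x \<partial>M)"
    using integral_suminf[OF 1 2 3] by (subst Bochner_Integration.integral_cong[OF refl S]) auto
  \<comment> \<open>\<open>has_sum\<close> means unconditional convergence, so convergence in the
    order of the enumeration does not suffice; absolute convergence does.\<close>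
  have "summable (\<lambda>n. norm (\<integral>x. f (e n) x \<partial>M))"
    by (rule summable_comparison_test'[OF 3]) simp
  then have "((\<lambda>n. \<integral>x. f (e n) x \<partial>M) has_sum (\<Sum>n. \<integral>x. f (e n) x \<partial>M)) UNIV"
    by (rule norm_summable_imp_has_sum[OF _ summable_sums[OF summable_norm_cancel]]) fact+
  then show "((\<lambda>i. \<integral>x. f i x \<partial>M) has_sum (\<integral>x. (\<Sum>\<^sub>\<infinity>i\<in>I. f i x) \<partial>M)) I"
    using has_sum_reindex_bij_betw[OF e, of "\<lambda>i. \<integral>x. f i x \<partial>M"] * by simp
qed

section \<open>Fourier uniqueness on the circle\<close>

definition echar :: "int \<Rightarrow> real \<Rightarrow> complex" where
  "echar k x = cis (2 * pi * of_int k * x)"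

lemma echar_add: "echar (j + k) x = echar j x * echar k x"
  by (simp add: echar_def cis_mult algebra_simps)

lemma norm_echar [simp]: "norm (echar k x) = 1"
  by (simp add: echar_def)

lemma continuous_on_echar [continuous_intros]: "continuous_on A (echar k)"
  unfolding echar_def cis_conv_exp by (intro continuous_intros)

text \<open>The quantification over all \<open>F\<close> and \<open>k\<close> makes the case of products in the induction immediate.\<close>

lemma orthogonal_real_polynomial:
  fixes F :: "real \<Rightarrow> complex"
  assumes "real_polynomial_function g"
    and "continuous_on {0..1} F"
    and "\<And>k. integral {0..1} (\<lambda>x. F x * echar k x) = 0"
  shows "integral {0..1} (\<lambda>x. F x * of_real (g (echar 1 x)) * echar k x) = 0"
  using assms
proof (induction arbitrary: F k rule: real_polynomial_function.induct)
  case (linear h)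
  \<comment> \<open>On the unit circle Re z = (z + 1/z)/2 and Im z = (z - 1/z)/(2i), so a real
    linear form in z is a combination of the characters of index 1 and -1; \<open>a\<close> and
    \<open>b\<close> are its coefficients.\<close>
  define a where "a = (complex_of_real (h 1) - \<i> * of_real (h \<i>)) / 2"
  define b where "b = (complex_of_real (h 1) + \<i> * of_real (h \<i>)) / 2"
  have h: "h z = Re z * h 1 + Im z * h \<i>" for z
  proof -
    interpret bounded_linear h by fact
    have "h z = h (Re z *\<^sub>R 1 + Im z *\<^sub>R \<i>)" by (rule arg_cong[where f=h]) (auto simp: complex_eq_iff)
    also have "\<dots> = Re z * h 1 + Im z * h \<i>" by (simp add: add scaleR)
    finally show ?thesis .
  qed
  have *: "of_real (h (echar 1 x)) = a * echar 1 x + b * echar (-1) x" for x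
    by (subst h) (auto simp: echar_def a_def b_def complex_eq_iff field_simps)
  have i: "(\<lambda>x. F x * echar j x) integrable_on {0..1}" for j
    by (intro integrable_continuous_real continuous_intros linear)
  have "integral {0..1} (\<lambda>x. F x * of_real (h (echar 1 x)) * echar k x)
      = integral {0..1} (\<lambda>x. a * (F x * echar (1 + k) x) + b * (F x * echar (- 1 + k) x))"
    by (intro integral_cong) (simp only: * echar_add, simp only: algebra_simps)
  also have "\<dots> = a * integral {0..1} (\<lambda>x. F x * echar (1 + k) x) + b * integral {0..1} (\<lambda>x. F x * echar (- 1 + k) x)"
    using i by (subst integral_add) (auto intro!: integrable_on_mult_right)
  also have "\<dots> = 0" by (simp only: linear) simp
  finally show ?case .
next
  case (const c)
  have "integral {0..1} (\<lambda>x. F x * of_real c * echar k x) = integral {0..1} (\<lambda>x. of_real c * (F x * echar k x))"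
    by (intro integral_cong) simp
  also have "\<dots> = 0" using const by simp
  finally show ?case .
next
  case (add f g)
  have cont: "continuous_on {0..1} (\<lambda>x. h (echar 1 x))" if "real_polynomial_function h" for h
    by (rule continuous_on_compose2[OF continuous_on_polymonial_function, of h])
      (use that in \<open>auto simp: real_polynomial_function_eq intro: continuous_intros\<close>)
  have i: "(\<lambda>x. F x * of_real (h (echar 1 x)) * echar k x) integrable_on {0..1}"
    if "real_polynomial_function h" for h
    by (intro integrable_continuous_real continuous_intros add.prems cont that)
  have "integral {0..1} (\<lambda>x. F x * of_real (f (echar 1 x) + g (echar 1 x)) * echar k x)
     = integral {0..1} (\<lambda>x. F x * of_real (f (echar 1 x)) * echar k x + F x * of_real (g (echar 1 x)) * echar k x)"
    by (intro integral_cong) (simp add: algebra_simps)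
  also have "\<dots> = 0"
    by (subst integral_add) (use add i in auto)
  finally show ?case .
next
  case (mult f g)
  have cont: "continuous_on {0..1} (\<lambda>x. h (echar 1 x))" if "real_polynomial_function h" for h
    by (rule continuous_on_compose2[OF continuous_on_polymonial_function, of h])
      (use that in \<open>auto simp: real_polynomial_function_eq intro: continuous_intros\<close>)
  have "integral {0..1} (\<lambda>x. (F x * of_real (f (echar 1 x))) * of_real (g (echar 1 x)) * echar k x) = 0"
    by (rule mult.IH(2)) (auto intro!: continuous_intros mult.prems cont mult.hyps mult.IH(1))
  thus ?case by (simp add: mult_ac)
qed

text \<open>Stone--Weierstrass: \<open>F\<close> descends to the circle, where polynomials in the two real coordinates
  are dense and, by the preceding lemma, orthogonal to \<open>F\<close>.\<close>

lemma continuous_fourier_unique: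
  fixes F :: "real \<Rightarrow> complex"
  assumes cont: "continuous_on {0..1} F" and per: "F 0 = F 1"
    and zero: "\<And>k. integral {0..1} (\<lambda>x. F x * echar k x) = 0"
    and x: "x \<in> {0..1}"
  shows "F x = 0"
proof -
  let ?C = "sphere (0::complex) 1"
  have surj: "echar 1 ` {0..1} = ?C"
  proof
    show "?C \<subseteq> echar 1 ` {0..1}"
    proof
      fix z :: complex assume z: "z \<in> ?C"
      define t where "t = Arg2pi z / (2 * pi)"
      have "z = echar 1 t"
        using z Arg2pi_eq[of z] by (auto simp: t_def echar_def cis_conv_exp)
      moreover have "t \<in> {0..1}"
        using Arg2pi_ge_0[of z] Arg2pi_lt_2pi[of z] by (auto simp: t_def field_simps)
      ultimately show "z \<in> echar 1 ` {0..1}" by blast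
    qed
  qed auto
  \<comment> \<open>\<open>echar 1\<close> identifies only the two endpoints of the interval, and
    there \<open>per\<close> applies.\<close>
  have eq: "F s = F t" if "s \<in> {0..1}" "t \<in> {0..1}" "echar 1 s = echar 1 t" for s t
  proof -
    have "exp (\<i> * of_real (2 * pi * s)) = exp (\<i> * of_real (2 * pi * t))"
      using that(3) by (simp add: echar_def cis_conv_exp)
    then obtain n :: int where
      "\<i> * of_real (2 * pi * s) = \<i> * of_real (2 * pi * t) + complex_of_real (of_int (2 * n) * pi) * \<i>"
      unfolding exp_eq by blast
    from arg_cong[where f = Im, OF this] have "2 * pi * s = 2 * pi * t + 2 * of_int n * pi"
      by simp
    also have "\<dots> = 2 * pi * (t + of_int n)" by (simp add: algebra_simps)
    finally have "s = t + of_int n" by simp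
    then have "s = t \<or> s = 0 \<and> t = 1 \<or> s = 1 \<and> t = 0" using that(1,2)
      by (cases "n = 0"; cases "n > 0") auto
    then show ?thesis using per by auto
  qed
  \<comment> \<open>A continuous surjection from a compact space onto a Hausdorff space is a
    quotient map, so \<open>F\<close>, being constant on its fibres, factors continuously through
    the circle.\<close>
  have q: "quotient_map (top_of_set {0..1}) (top_of_set ?C) (echar 1)"
  proof (rule T1_Spaces.continuous_imp_quotient_map)
    show "continuous_map (top_of_set {0..1}) (top_of_set ?C) (echar 1)"
      by (auto simp: continuous_on_echar)
    show "compact_space (top_of_set {0..1::real})" by (simp add: compact_space_subtopology)
    show "Hausdorff_space (top_of_set ?C)"
      by (simp add: Hausdorff_space_subtopology)
  qed (simp add: surj)
  obtain f where f: "continuous_on ?C f" "\<And>x. x \<in> {0..1} \<Longrightarrow> f (echar 1 x) = F x"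
  proof -
    have "continuous_map (top_of_set {0..1}) euclidean F" using cont by simp
    from quotient_map_lift_exists[OF q this] eq
    obtain f where f: "continuous_map (top_of_set ?C) euclidean f" "\<And>x. x \<in> {0..1} \<Longrightarrow> f (echar 1 x) = F x"
      unfolding topspace_euclidean_subtopology by metis
    then show ?thesis using that[of f] by simp
  qed
  define N where "N = integral {0..1} (\<lambda>x. norm (F x))"
  have N: "N \<ge> 0" unfolding N_def 
    by (intro integral_nonneg integrable_continuous_real continuous_intros cont) auto
  have cont2: "continuous_on {0..1} (\<lambda>x. (norm (F x))\<^sup>2)"
    by (intro continuous_intros cont)
  \<comment> \<open>If g approximates F within e, orthogonality lets F * cnj g be subtracted from F
    * cnj F at no cost: the integral of |F|^2 equals that of F * cnj (F - g).\<close>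
  have le: "integral {0..1} (\<lambda>x. (norm (F x))\<^sup>2) \<le> e * N" if e: "e > 0" for e
  proof -
    obtain g where g: "polynomial_function g" "\<And>z. z \<in> ?C \<Longrightarrow> norm (f z - g z) < e"
      using Stone_Weierstrass_polynomial_function[OF compact_sphere f(1) e] by blast
    have gc: "continuous_on {0..1} (\<lambda>x. g (echar 1 x))"
      by (rule continuous_on_compose2[OF continuous_on_polymonial_function[OF g(1)] continuous_on_echar subset_UNIV])
    have r: "real_polynomial_function (\<lambda>x. Re (g x))" "real_polynomial_function (\<lambda>x. Im (g x))"
      using g(1) bounded_linear_Re bounded_linear_Im unfolding polynomial_function_def o_def by auto
    have i: "(\<lambda>x. F x * of_real (h (g (echar 1 x)))) integrable_on {0..1}" if "continuous_on UNIV h" for h :: "complex \<Rightarrow> real"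
      by (intro integrable_continuous_real continuous_intros cont continuous_on_compose2[OF that gc]) auto
    have z: "integral {0..1} (\<lambda>x. F x * of_real (Re (g (echar 1 x)))) = 0"
       "integral {0..1} (\<lambda>x. F x * of_real (Im (g (echar 1 x)))) = 0"
      using orthogonal_real_polynomial[OF r(1) cont zero, of 0] orthogonal_real_polynomial[OF r(2) cont zero, of 0]
      by (simp_all add: echar_def)
    have "integral {0..1} (\<lambda>x. F x * cnj (g (echar 1 x))) =
       integral {0..1} (\<lambda>x. F x * of_real (Re (g (echar 1 x))) - \<i> * (F x * of_real (Im (g (echar 1 x)))))"
      by (intro integral_cong) (simp add: complex_eq_iff algebra_simps)
    also have "\<dots> = 0"
      using i[OF continuous_on_Re[OF continuous_on_id]] i[OF continuous_on_Im[OF continuous_on_id]] z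
      by (subst integral_diff) (auto intro!: integrable_on_mult_right)
    finally have 0: "integral {0..1} (\<lambda>x. F x * cnj (g (echar 1 x))) = 0" .
    have i1: "(\<lambda>x. F x * cnj (g (echar 1 x))) integrable_on {0..1}"
      by (intro integrable_continuous_real continuous_intros cont gc)
    have i2: "(\<lambda>x. F x * cnj (F x)) integrable_on {0..1}"
      by (intro integrable_continuous_real continuous_intros cont)
    have "complex_of_real (integral {0..1} (\<lambda>x. (norm (F x))\<^sup>2)) = integral {0..1} (\<lambda>x. F x * cnj (F x))"
    proof (rule integral_unique[symmetric])
      have "((\<lambda>x. complex_of_real ((norm (F x))\<^sup>2)) has_integral
          of_real (integral {0..1} (\<lambda>x. (norm (F x))\<^sup>2))) {0..1}"
        by (intro has_integral_of_real integrable_integral integrable_continuous_real cont2)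
      then show "((\<lambda>x. F x * cnj (F x)) has_integral
          of_real (integral {0..1} (\<lambda>x. (norm (F x))\<^sup>2))) {0..1}"
        by (simp only: complex_norm_square)
    qed
    also have "\<dots> = integral {0..1} (\<lambda>x. F x * cnj (F x) - F x * cnj (g (echar 1 x)))"
      using i1 i2 0 by (subst integral_diff) auto
    finally have eq: "complex_of_real (integral {0..1} (\<lambda>x. (norm (F x))\<^sup>2)) = \<dots>" .
    have "integral {0..1} (\<lambda>x. (norm (F x))\<^sup>2) \<le> norm (integral {0..1} (\<lambda>x. F x * cnj (F x) - F x * cnj (g (echar 1 x))))"
      unfolding eq[symmetric] norm_of_real by (rule abs_ge_self)
    also have "\<dots> \<le> integral {0..1} (\<lambda>x. e * norm (F x))"
    proof (intro integral_norm_bound_integral)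
      fix x :: real assume x: "x \<in> {0..1}"
      then have "echar 1 x \<in> ?C" by simp
      from g(2)[OF this] have "norm (F x - g (echar 1 x)) \<le> e" using f(2)[OF x] by simp
      have "norm (F x * cnj (F x) - F x * cnj (g (echar 1 x))) = norm (F x) * norm (cnj (F x - g (echar 1 x)))"
        by (simp only: norm_mult[symmetric] complex_cnj_diff right_diff_distrib)
      also have "\<dots> \<le> norm (F x) * e"
        using \<open>norm (F x - g (echar 1 x)) \<le> e\<close> by (intro mult_left_mono) (simp_all only: complex_mod_cnj norm_ge_zero)
      finally show "norm (F x * cnj (F x) - F x * cnj (g (echar 1 x))) \<le> e * norm (F x)" by (simp add: mult.commute)
    qed (intro integrable_diff i1 i2 integrable_continuous_real continuous_intros cont)+
    also have "\<dots> = e * N" by (simp add: N_def)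
    finally show ?thesis .
  qed
  have "integral {0..1} (\<lambda>x. (norm (F x))\<^sup>2) \<le> 0"
  proof (rule field_le_epsilon)
    fix e :: real assume "e > 0"
    \<comment> \<open>The denominator \<open>N + 1\<close> instead of \<open>N\<close> covers
      \<open>N = 0\<close>.\<close>
    then have "integral {0..1} (\<lambda>x. (norm (F x))\<^sup>2) \<le> e / (N + 1) * N" using N by (intro le) auto
    also have "\<dots> \<le> e" using N \<open>e > 0\<close> by (simp add: field_simps)
    finally show "integral {0..1} (\<lambda>x. (norm (F x))\<^sup>2) \<le> 0 + e" by simp
  qed
  moreover have "integral {0..1} (\<lambda>x. (norm (F x))\<^sup>2) \<ge> 0"
    by (intro integral_nonneg integrable_continuous_real cont2) auto
  ultimately have "integral {0..1} (\<lambda>x. (norm (F x))\<^sup>2) = 0" by simp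
  then have "\<forall>x\<in>{0..1}. (norm (F x))\<^sup>2 = 0"
    using integral_eq_0_iff[OF cont2] by simp
  then show ?thesis using x by simp
qed

section \<open>Poisson summation on the real line\<close>

lemma continuous_on_infsum:
  fixes f :: "'i \<Rightarrow> 'a::topological_space \<Rightarrow> 'b::banach"
  assumes "\<And>i. i \<in> I \<Longrightarrow> continuous_on A (f i)"
    and "\<And>i x. i \<in> I \<Longrightarrow> x \<in> A \<Longrightarrow> norm (f i x) \<le> B i"
    and "B summable_on I"
  shows "continuous_on A (\<lambda>x. \<Sum>\<^sub>\<infinity>i\<in>I. f i x)"
proof (rule uniform_limit_theorem[OF _ Weierstrass_m_test_general[OF assms(2,3)]])
  show "\<forall>\<^sub>F J in finite_subsets_at_top I. continuous_on A (\<lambda>x. \<Sum>i\<in>J. f i x)"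
    by (rule eventually_finite_subsets_at_top_weakI) (auto intro!: continuous_on_sum assms(1))
qed auto

lemma integral_echar:
  "integral {0..1} (echar k) = (if k = 0 then 1 else 0)"
proof (cases "k = 0")
  case False
  define c where "c = 2 * pi * of_int k * \<i>"
  have c: "c \<noteq> 0" using False by (simp add: c_def)
  have e: "echar k x = exp (of_real x * c)" for x
    by (simp add: echar_def cis_conv_exp c_def mult_ac)
  have "((\<lambda>z. exp (z * c) / c) has_field_derivative exp (z * c)) (at z)" for z
    using c by (auto intro!: derivative_eq_intros)
  then have "((\<lambda>x. exp (of_real x * c) / c) has_vector_derivative exp (of_real x * c)) (at x within {0..1})" for x
    by (rule has_vector_derivative_real_field)
  then have "((\<lambda>x. exp (of_real x * c)) has_integral (exp (of_real 1 * c) / c - exp (of_real 0 * c) / c)) {0..1}"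
    by (intro fundamental_theorem_of_calculus) auto
  then have "integral {0..1} (echar k) = exp (of_real 1 * c) / c - exp (of_real 0 * c) / c"
    unfolding e[symmetric] by (rule integral_unique)
  also have "exp (of_real 1 * c) = 1"
    using exp_2pi_1_int[of k] by (simp add: c_def mult_ac)
  finally show ?thesis
    using False by simp
qed (simp add: echar_def[abs_def])

lemma echar_of_int [simp]: "echar k (of_int n) = 1"
  using cis_multiple_2pi[of "of_int (k * n)"] by (simp add: echar_def mult.assoc)

lemma echar_shift [simp]: "echar k (x + of_int n) = echar k x"
proof -
  have "echar k (x + of_int n) = echar k x * echar k (of_int n)"
    by (simp add: echar_def cis_mult algebra_simps)
  then show ?thesis by (simp only: echar_of_int) simp
qed

text \<open>The interval is half-open because its integer translates tile the line without overlap;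
  the missing endpoint is a null set.\<close>

lemma lebesgue_integral_unit_interval:
  fixes f :: "real \<Rightarrow> complex"
  assumes "continuous_on {0..1} f"
  shows "(\<integral>x. indicator {0..<1} x *\<^sub>R f x \<partial>lborel) = integral {0..1} f"
    and "integrable lborel (\<lambda>x. indicator {0..<1} x *\<^sub>R f x)"
proof -
  have i: "set_integrable lborel {0..1} f"
    by (rule borel_integrable_atLeastAtMost'[OF assms])
  then have i2: "set_integrable lborel {0..<1} f" by (rule set_integrable_subset) auto
  show "integrable lborel (\<lambda>x. indicator {0..<1} x *\<^sub>R f x)"
    using i2 by (simp add: set_integrable_def)
  have "(\<integral>x. indicator {0..<1} x *\<^sub>R f x \<partial>lborel) = (\<integral>x. indicator {0..1} x *\<^sub>R f x \<partial>lborel)"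
    using i i2 AE_lborel_singleton[of "1::real"]
    by (intro integral_cong_AE) (auto simp: set_integrable_def indicator_def)
  also have "\<dots> = integral {0..1} f"
    using set_borel_integral_eq_integral(2)[OF i] by (simp add: set_lebesgue_integral_def)
  finally show "(\<integral>x. indicator {0..<1} x *\<^sub>R f x \<partial>lborel) = integral {0..1} f" .
qed

text \<open>The periodization \<open>F\<close> of \<open>g\<close> and the trigonometric series
  \<open>G\<close> built from the Fourier transform of \<open>g\<close> are both continuous with
  equal values at 0 and 1, and they have the same Fourier coefficients. Hence they coincide, and the
  claim is their equality at 0. The majorant \<open>b\<close> makes \<open>F\<close> continuous, and
  \<open>ft\<close> does the same for \<open>G\<close>.\<close>

theorem poisson_summation:
  fixes g :: "real \<Rightarrow> complex" and b :: "int \<Rightarrow> real"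
  assumes cont: "continuous_on UNIV g"
    and bound: "\<And>m x. x \<in> {0..1} \<Longrightarrow> norm (g (x + of_int m)) \<le> b m"
    and b: "b summable_on UNIV"
    and ft: "(\<lambda>k. norm (\<integral>x. g x * echar (- k) x \<partial>lborel)) summable_on (UNIV :: int set)"
  shows "(\<Sum>\<^sub>\<infinity>m. g (of_int m)) = (\<Sum>\<^sub>\<infinity>k. \<integral>x. g x * echar (- k) x \<partial>lborel)"
proof -
  define h where "h k = (\<integral>x. g x * echar (- k) x \<partial>lborel)" for k
  define F where "F x = (\<Sum>\<^sub>\<infinity>m. g (x + of_int m))" for x
  define G where "G x = (\<Sum>\<^sub>\<infinity>k. h k * echar k x)" for x
  have gm: "continuous_on A (\<lambda>x. g (x + of_int m))" for m A
    by (rule continuous_on_compose2[OF cont]) (auto intro: continuous_intros)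
  have gb [measurable]: "g \<in> borel_measurable borel"
    by (rule borel_measurable_continuous_onI[OF cont])
  have eb [measurable]: "echar k \<in> borel_measurable borel" for k
    by (rule borel_measurable_continuous_onI[OF continuous_on_echar])
  have contF: "continuous_on {0..1} F"
    unfolding F_def by (rule continuous_on_infsum[OF gm bound b])
  have contG: "continuous_on {0..1} G"
    unfolding G_def using ft
    by (intro continuous_on_infsum[where B = "\<lambda>k. norm (h k)"] continuous_intros)
      (auto simp: norm_mult h_def)
  have F_abs: "(\<lambda>m. norm (g (x + of_int m))) summable_on UNIV" if "x \<in> {0..1}" for x
    by (rule summable_on_comparison_test[OF b]) (use bound[OF that] in auto)
  have h_abs: "(\<lambda>k. norm (h k)) summable_on UNIV" using ft by (simp add: h_def)
  have F10: "F 0 = F 1"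
  proof -
    have "bij (\<lambda>m::int. 1 + m)"
      by (intro bij_betwI[where g = "\<lambda>m. m - 1"]) auto
    from infsum_reindex_bij_betw[OF this, of "\<lambda>m. g (of_int m)"] show ?thesis
      by (simp add: F_def)
  qed
  have G10: "G 0 = G 1"
    using echar_of_int[of _ 0] echar_of_int[of _ 1] unfolding G_def by simp
  have intF: "integral {0..1} (\<lambda>x. F x * echar j x) = h (- j)" for j
  proof -
    define H where "H x = g x * echar j x" for x
    have contH: "continuous_on A (\<lambda>x. H (x + of_int m))" for A m
      unfolding H_def echar_shift by (intro continuous_intros gm)
    have normH: "norm (H x) = norm (g x)" for x by (simp add: H_def norm_mult)
    have [measurable]: "H \<in> borel_measurable borel" unfolding H_def by measurable
    \<comment> \<open>The same integrals are summed in two ways. The pieces \<open>f m\<close> all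
      live on the unit interval and add up to the periodization; the pieces \<open>f' m\<close> live
      on consecutive intervals and add up to \<open>H\<close> on the whole line. The character is
      unaffected by the translation, as its period is 1.\<close>
    define f where "f m x = indicator {0..<1::real} x *\<^sub>R H (x + of_int m)" for m :: int and x :: real
    define f' where "f' m x = indicator {of_int m..<of_int m + 1::real} x *\<^sub>R H x" for m :: int and x :: real
    have f_int: "integrable lborel (f m)" for m
      unfolding f_def by (intro lebesgue_integral_unit_interval contH)
    have ff': "f' m (of_int m + 1 * x) = f m x" for m x
      by (simp add: f_def f'_def indicator_def add.commute)
    have f'_int: "integrable lborel (f' m)" for m
      using f_int[of m] lborel_integrable_real_affine_iff[of 1 "f' m" "of_int m"]
      by (simp only: ff')
    have eq_int: "(\<integral>x. f' m x \<partial>lborel) = (\<integral>x. f m x \<partial>lborel)" for m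
      by (subst lborel_integral_real_affine[of 1 _ "of_int m"]) (simp_all only: ff' scaleR_one abs_one)
    have eq_norm: "(\<integral>x. norm (f' m x) \<partial>lborel) = (\<integral>x. norm (f m x) \<partial>lborel)" for m
      by (subst lborel_integral_real_affine[of 1 _ "of_int m"]) (simp_all only: ff' scaleR_one abs_one)
    have le_b: "(\<integral>x. norm (f m x) \<partial>lborel) \<le> b m" for m
    proof -
      have "integrable lborel (\<lambda>x. indicator {0..<1::real} x *\<^sub>R b m)"
        by (intro integrable_scaleR_left integrable_real_indicator) auto
      then have "(\<integral>x. norm (f m x) \<partial>lborel) \<le> (\<integral>x. indicator {0..<1::real} x *\<^sub>R b m \<partial>lborel)"
        using bound[of _ m]
        by (intro integral_mono integrable_norm f_int) (auto simp: f_def normH indicator_def)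
      also have "\<dots> = b m" by simp
      finally show ?thesis .
    qed
    have sum_f: "(\<lambda>m. \<integral>x. norm (f m x) \<partial>lborel) summable_on UNIV"
      by (rule summable_on_comparison_test[OF b]) (use le_b in auto)
    have 1: "((\<lambda>m. \<integral>x. f m x \<partial>lborel) has_sum (\<integral>x. (\<Sum>\<^sub>\<infinity>m. f m x) \<partial>lborel)) UNIV"
    proof (rule has_sum_integral(2)[OF _ _ f_int sum_f])
      show "(\<lambda>m. norm (f m x)) summable_on UNIV" for x
        \<comment> \<open>Outside the half-open unit interval all terms \<open>f m x\<close> vanish,
          so any point of the interval, here 0, provides a majorant.\<close>
        by (rule summable_on_comparison_test[OF F_abs[of "if x \<in> {0..1} then x else 0"]])
          (auto simp: f_def normH indicator_def)
    qed auto
    have "(\<Sum>\<^sub>\<infinity>m. f m x) = indicator {0..<1} x *\<^sub>R (F x * echar j x)" for x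
    proof (cases "x \<in> {0..<1}")
      case True
      then show ?thesis
        by (simp add: f_def H_def F_def infsum_cmult_left')
    qed (simp add: f_def)
    then have "(\<integral>x. (\<Sum>\<^sub>\<infinity>m. f m x) \<partial>lborel) = integral {0..1} (\<lambda>x. F x * echar j x)"
      by (simp add: lebesgue_integral_unit_interval(1) continuous_on_mult contF continuous_on_echar)
    with 1 have 1: "((\<lambda>m. \<integral>x. f m x \<partial>lborel) has_sum integral {0..1} (\<lambda>x. F x * echar j x)) UNIV"
      by simp
    have floor: "f' m x = (if m = \<lfloor>x\<rfloor> then H x else 0)" for m x
    proof -
      have "x \<in> {of_int m..<of_int m + 1} \<longleftrightarrow> m = \<lfloor>x\<rfloor>" by (auto simp: floor_unique) linarith?
      then show ?thesis by (simp add: f'_def indicator_def)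
    qed
    have hs: "((\<lambda>m. f' m x) has_sum H x) UNIV" for x
      unfolding floor by (rule has_sum_finite_neutralI[where B = "{\<lfloor>x\<rfloor>}"]) auto
    have 2: "((\<lambda>m. \<integral>x. f' m x \<partial>lborel) has_sum (\<integral>x. (\<Sum>\<^sub>\<infinity>m. f' m x) \<partial>lborel)) UNIV"
    proof (rule has_sum_integral(2)[OF _ _ f'_int])
      show "(\<lambda>m. \<integral>x. norm (f' m x) \<partial>lborel) summable_on UNIV" using sum_f by (simp only: eq_norm)
      show "(\<lambda>m. norm (f' m x)) summable_on UNIV" for x
        using has_sum_imp_summable[OF has_sum_finite_neutralI[of "{\<lfloor>x\<rfloor>}" UNIV "\<lambda>m. norm (f' m x)"]]
        by (simp add: floor)
    qed auto
    have "(\<integral>x. (\<Sum>\<^sub>\<infinity>m. f' m x) \<partial>lborel) = h (- j)"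
      unfolding infsumI[OF hs] by (simp add: h_def H_def)
    with 2 have "((\<lambda>m. \<integral>x. f m x \<partial>lborel) has_sum h (- j)) UNIV" by (simp add: eq_int)
    with 1 show ?thesis using has_sum_unique by blast
  qed
  have intG: "integral {0..1} (\<lambda>x. G x * echar j x) = h (- j)" for j
  proof -
    define f where "f k x = indicator {0..<1::real} x *\<^sub>R (h k * echar (k + j) x)" for k :: int and x :: real
    have c: "continuous_on {0..1} (\<lambda>x. h k * echar (k + j) x)" for k
      by (intro continuous_intros)
    have f_int: "integrable lborel (f k)" for k
      unfolding f_def by (intro lebesgue_integral_unit_interval c)
    have "(\<integral>x. norm (f k x) \<partial>lborel) = (\<integral>x. indicator {0..<1::real} x *\<^sub>R norm (h k) \<partial>lborel)" for k
      by (intro Bochner_Integration.integral_cong) (auto simp: f_def norm_mult)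
    then have n: "(\<integral>x. norm (f k x) \<partial>lborel) = norm (h k)" for k by simp
    have 1: "((\<lambda>k. \<integral>x. f k x \<partial>lborel) has_sum (\<integral>x. (\<Sum>\<^sub>\<infinity>k. f k x) \<partial>lborel)) UNIV"
    proof (rule has_sum_integral(2)[OF _ _ f_int])
      show "(\<lambda>k. \<integral>x. norm (f k x) \<partial>lborel) summable_on UNIV" using h_abs by (simp add: n)
      show "(\<lambda>k. norm (f k x)) summable_on UNIV" for x
        by (rule summable_on_comparison_test[OF h_abs]) (auto simp: f_def norm_mult indicator_def)
    qed auto
    have "(\<Sum>\<^sub>\<infinity>k. f k x) = indicator {0..<1} x *\<^sub>R (G x * echar j x)" for x
    proof (cases "x \<in> {0..<1}")
      case True
      then show ?thesis
        by (simp add: f_def G_def echar_add infsum_cmult_left' flip: mult.assoc)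
    qed (simp add: f_def)
    then have 2: "(\<integral>x. (\<Sum>\<^sub>\<infinity>k. f k x) \<partial>lborel) = integral {0..1} (\<lambda>x. G x * echar j x)"
      by (simp add: lebesgue_integral_unit_interval(1) continuous_on_mult contG continuous_on_echar)
    \<comment> \<open>Orthogonality of the characters leaves the single index
      \<open>k = - j\<close>.\<close>
    have "(\<integral>x. f k x \<partial>lborel) = (if k = - j then h (- j) else 0)" for k
      unfolding f_def lebesgue_integral_unit_interval(1)[OF c] integral_mult_right integral_echar
      by auto
    then have 3: "((\<lambda>k. if k = - j then h (- j) else 0) has_sum integral {0..1} (\<lambda>x. G x * echar j x)) UNIV"
      using 1 by (simp add: 2)
    have "((\<lambda>k. if k = - j then h (- j) else 0) has_sum h (- j)) UNIV"
      by (rule has_sum_finite_neutralI[where B = "{- j}"]) auto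
    with 3 show ?thesis using has_sum_unique by blast
  qed
  have "F 0 - G 0 = 0"
  proof (rule continuous_fourier_unique[where F = "\<lambda>x. F x - G x"])
    show "integral {0..1} (\<lambda>x. (F x - G x) * echar k x) = 0" for k
      unfolding left_diff_distrib
      by (subst integral_diff)
        (auto intro!: integrable_continuous_real continuous_intros contF contG simp: intF intG)
  qed (use F10 G10 in \<open>auto intro!: continuous_intros contF contG\<close>)
  then show ?thesis by (simp add: F_def G_def h_def echar_def)
qed

section \<open>Gaussian integrals and Bessel functions\<close>

text \<open>Two one-sided geometric series, one for each sign of the index, give the factor 2. The
  case \<open>N = 0\<close> yields the exponential majorants used for summability, the case
  \<open>N = M\<close> the truncation error.\<close>

lemma has_sum_geometric_abs_tail:
  fixes q :: real
  assumes q: "0 \<le> q" "q < 1"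
  shows "((\<lambda>m::int. q ^ nat \<bar>m\<bar>) has_sum (2 * q ^ Suc N / (1 - q))) {m. \<bar>m\<bar> > int N}"
proof -
  let ?f = "\<lambda>m::int. q ^ nat \<bar>m\<bar>"
  let ?p = "\<lambda>i. int N + 1 + int i"
  have "(\<lambda>i. q ^ Suc N * q ^ i) sums (q ^ Suc N * (1 / (1 - q)))"
    using q by (intro sums_mult geometric_sums) simp
  then have g: "((\<lambda>i. q ^ (Suc N + i)) has_sum (q ^ Suc N / (1 - q))) UNIV"
    using q by (intro sums_nonneg_imp_has_sum) (auto simp: power_add mult.assoc)
  have "nat \<bar>?p i\<bar> = Suc N + i" "nat \<bar>- ?p i\<bar> = Suc N + i" for i by arith+
  then have "?f \<circ> ?p = (\<lambda>i. q ^ (Suc N + i))" "?f \<circ> (\<lambda>i. - ?p i) = (\<lambda>i. q ^ (Suc N + i))"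
    by (simp_all only: o_def)
  with g have 1: "(?f has_sum (q ^ Suc N / (1 - q))) (range ?p)"
    and 2: "(?f has_sum (q ^ Suc N / (1 - q))) (range (\<lambda>i. - ?p i))"
    by (auto simp: has_sum_reindex inj_on_def simp del: power_Suc)
  have "{m. \<bar>m\<bar> > int N} = range ?p \<union> range (\<lambda>i. - ?p i)"
  proof (intro equalityI subsetI)
    fix m :: int assume m: "m \<in> {m. \<bar>m\<bar> > int N}"
    then have "m = ?p (nat (m - int N - 1)) \<or> m = - ?p (nat (- m - int N - 1))" by auto
    then show "m \<in> range ?p \<union> range (\<lambda>i. - ?p i)" by blast
  qed auto
  moreover have "range ?p \<inter> range (\<lambda>i. - ?p i) = {}" by auto
  ultimately show ?thesis
    using has_sum_Un_disjoint[OF 1 2] by (simp add: field_simps)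
qed

lemma summable_on_exp_abs_int:
  fixes a :: real
  assumes "a > 0"
  shows "(\<lambda>m::int. exp (- (a * \<bar>real_of_int m\<bar>))) summable_on UNIV"
proof -
  have e: "exp (- (a * \<bar>real_of_int m\<bar>)) = exp (- a) ^ nat \<bar>m\<bar>" for m
    by (simp add: mult.commute flip: exp_of_nat_mult)
  have "(\<lambda>m::int. exp (- a) ^ nat \<bar>m\<bar>) summable_on {m. \<bar>m\<bar> > int 0}"
    using has_sum_geometric_abs_tail[of "exp (- a)" 0] assms by (auto simp: summable_on_def)
  then have "(\<lambda>m::int. exp (- a) ^ nat \<bar>m\<bar>) summable_on (insert 0 {m. \<bar>m\<bar> > int 0})"
    by (simp add: summable_on_insert_iff)
  moreover have "insert 0 {m. \<bar>m\<bar> > int 0} = UNIV" by auto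
  ultimately show ?thesis by (simp add: e)
qed

text \<open>This is the characteristic function of the standard normal distribution after rescaling
  the variable by \<open>sqrt (2 * a)\<close>.\<close>

lemma gaussian_fourier_transform:
  fixes a t :: real
  assumes a: "a > 0"
  shows "(\<integral>x. of_real (exp (- a * x\<^sup>2)) * cis (t * x) \<partial>lborel)
           = of_real (sqrt (pi / a) * exp (- (t\<^sup>2 / (4 * a))))"
proof -
  define g where "g t x = of_real (exp (- (x\<^sup>2 / 2))) * cis (t * x)" for t x :: real
  have gv: "(\<integral>x. g t x \<partial>lborel) = of_real (sqrt (2 * pi) * exp (- (t\<^sup>2 / 2)))" for t
  proof -
    have "complex_of_real (exp (- (t\<^sup>2) / 2)) = (\<integral>x. std_normal_density x *\<^sub>R iexp (t * x) \<partial>lborel)"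
      using fun_cong[OF char_std_normal_distribution, of t]
      by (simp add: char_def integral_density normal_density_nonneg)
    also have "\<dots> = (\<integral>x. of_real (1 / sqrt (2 * pi)) * g t x \<partial>lborel)"
      by (intro Bochner_Integration.integral_cong)
        (auto simp: g_def std_normal_density_def scaleR_conv_of_real cis_conv_exp)
    also have "\<dots> = of_real (1 / sqrt (2 * pi)) * (\<integral>x. g t x \<partial>lborel)" by simp
    finally show ?thesis by (simp add: field_simps)
  qed
  have sq: "g (t / sqrt (2 * a)) (0 + sqrt (2 * a) * x) = of_real (exp (- a * x\<^sup>2)) * cis (t * x)" for x
    using a by (simp add: g_def power_mult_distrib)
  have s0: "sqrt (2 * a) \<noteq> 0" using a by simp
  have "(\<integral>x. g (t / sqrt (2 * a)) x \<partial>lborel) =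
      sqrt (2 * a) *\<^sub>R (\<integral>x. of_real (exp (- a * x\<^sup>2)) * cis (t * x) \<partial>lborel)"
    using a by (subst lborel_integral_real_affine[OF s0, of _ 0]) (simp only: sq, simp)
  then have "of_real (sqrt (2 * a)) * (\<integral>x. of_real (exp (- a * x\<^sup>2)) * cis (t * x) \<partial>lborel)
      = complex_of_real (sqrt (2 * pi) * exp (- (t\<^sup>2 / (4 * a))))"
    using a by (simp add: gv power_divide scaleR_conv_of_real field_simps)
  then show "(\<integral>x. of_real (exp (- a * x\<^sup>2)) * cis (t * x) \<partial>lborel)
           = of_real (sqrt (pi / a) * exp (- (t\<^sup>2 / (4 * a))))"
    using a by (simp add: real_sqrt_mult real_sqrt_divide field_simps)
qed

text \<open>A shift of \<open>v\<close> balances the two exponentials: both become (b r/2) exp(u)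
  and (b r/2) exp(-u), whose sum is b r cosh u. The integrand is then even, so the full line counts
  the half-line integral of \<open>bessel_K\<close> twice. Integrability is an assumption because
  the application obtains it by domination by a summed series.\<close>

lemma bessel_K_0_integral_exp:
  fixes b r :: real
  assumes b: "b > 0" and r: "r > 0"
    and int: "integrable lborel (\<lambda>v. exp (- (b\<^sup>2 * exp v) - r\<^sup>2 * exp (- v) / 4))"
  shows "bessel_K 0 (b * r) = 1 / 2 * (\<integral>v. exp (- (b\<^sup>2 * exp v) - r\<^sup>2 * exp (- v) / 4) \<partial>lborel)"
proof -
  define h where "h v = exp (- (b\<^sup>2 * exp v) - r\<^sup>2 * exp (- v) / 4)" for v
  define f where "f u = exp (- (b * r) * cosh u)" for u
  define c where "c = ln (r / (2 * b))" \<comment> \<open>the shift that turns \<open>b r cosh u\<close> into the exponent of \<open>h\<close>\<close>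
  have [measurable]: "f \<in> borel_measurable borel"
    unfolding f_def by (intro borel_measurable_continuous_onI continuous_intros)
  have hf: "h (c + 1 * u) = f u" for u
  proof -
    have "exp c = r / (2 * b)" "exp (- c) = 2 * b / r" using b r by (simp_all add: c_def exp_minus)
    then have "b\<^sup>2 * exp (c + u) = b * r / 2 * exp u" "r\<^sup>2 * exp (- (c + u)) / 4 = b * r / 2 * exp (- u)"
      using b r by (simp_all add: exp_add exp_diff exp_minus field_simps power2_eq_square)
    then show ?thesis
      unfolding h_def f_def mult_1 by (simp add: cosh_def field_simps)
  qed
  have fi: "integrable lborel f"
    using lborel_integrable_real_affine[OF int[folded h_def], of 1 c] by (simp only: hf)
  have eq: "(\<integral>v. h v \<partial>lborel) = (\<integral>u. f u \<partial>lborel)"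
    by (subst lborel_integral_real_affine[of 1 _ c]) (simp_all only: hf abs_one scaleR_one simp_thms one_neq_zero)
  have "bessel_K 0 (b * r) = (\<integral>u. indicator {0..} u *\<^sub>R f u \<partial>lborel)"
    by (simp add: bessel_K_def set_lebesgue_integral_def f_def)
  moreover have "integrable lborel (\<lambda>u. indicator {0..} u *\<^sub>R f u)"
    by (rule Bochner_Integration.integrable_bound[OF fi]) (auto simp: indicator_def)
  ultimately have "has_bochner_integral lborel (\<lambda>u. indicator {0..} u *\<^sub>R f u) (bessel_K 0 (b * r))"
    by (simp add: has_bochner_integral_iff)
  then have "has_bochner_integral lborel f (2 *\<^sub>R bessel_K 0 (b * r))"
    by (intro has_bochner_integral_even_function) (simp_all add: f_def)
  then show ?thesis
    using eq by (simp add: has_bochner_integral_iff h_def)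
qed

lemma has_bochner_integral_gaussian:
  "has_bochner_integral lborel (\<lambda>x::real. exp (- x\<^sup>2)) (sqrt pi)"
  using has_bochner_integral_even_function[OF gaussian_moment_0] by simp

text \<open>The exponent is \<open>- \<phi>\<^sup>2 - \<kappa> Y\<close> with \<open>\<phi> = \<kappa> e\<^bsup>v/2\<^esup> - (Y/2) e\<^bsup>-v/2\<^esup>\<close>.  The reflection
  \<open>v \<mapsto> 2 ln (Y / (2 \<kappa>)) - v\<close> swaps the two terms of \<open>\<phi>\<close>, so the factor \<open>e\<^bsup>v/2\<^esup>\<close> may be replaced by a
  multiple of \<open>\<phi>'\<close>, after which \<open>\<phi>\<close> is substituted.\<close>

lemma has_bochner_integral_bessel_half:
  fixes \<kappa> Y :: real
  assumes \<kappa>: "\<kappa> > 0" and Y: "Y > 0"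
  shows "has_bochner_integral lborel (\<lambda>v. exp (- (\<kappa>\<^sup>2 * exp v) - Y\<^sup>2 * exp (- v) / 4) * exp (v / 2))
     (sqrt pi / \<kappa> * exp (- \<kappa> * Y))"
proof -
  define \<phi> where "\<phi> v = \<kappa> * exp (v / 2) - Y / 2 * exp (- (v / 2))" for v
  define \<phi>' where "\<phi>' v = (\<kappa> * exp (v / 2) + Y / 2 * exp (- (v / 2))) / 2" for v
  define E where "E v = exp (- (\<phi> v)\<^sup>2)" for v
  define A where "A v = E v * (\<kappa> * exp (v / 2))" for v
  \<comment> \<open>\<open>A + B\<close> is twice \<open>\<phi>' * E\<close>, whose integral is
    known after substitution. Since the reflection exchanges \<open>A\<close> and \<open>B\<close>,
    each has integral \<open>sqrt pi\<close>.\<close>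
  define B where "B v = E v * (Y / 2 * exp (- (v / 2)))" for v
  have [measurable]: "E \<in> borel_measurable borel" "A \<in> borel_measurable borel" "B \<in> borel_measurable borel" "\<phi>' \<in> borel_measurable borel"
    unfolding A_def B_def E_def \<phi>_def \<phi>'_def by measurable
  have pos: "\<phi>' v > 0" for v unfolding \<phi>'_def using \<kappa> Y by (simp add: add_pos_pos)
  have der: "(\<phi> has_field_derivative \<phi>' v) (at v within UNIV)" for v
    unfolding \<phi>_def \<phi>'_def by (auto intro!: derivative_eq_intros simp: field_simps)
  have inj: "inj \<phi>"
  proof (rule injI)
    fix x y assume "\<phi> x = \<phi> y"
    moreover have "\<phi> u < \<phi> v" if "u < v" for u v
      using that \<kappa> Y by (auto simp: \<phi>_def intro!: diff_strict_mono)
    ultimately show "x = y" by (metis less_irrefl linorder_neqE)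
  qed
  have surj: "range \<phi> = UNIV"
  proof -
    have "t \<in> range \<phi>" for t
    proof -
      \<comment> \<open>With w = exp(v/2) the equation \<open>\<phi> v = t\<close> is the quadratic
        2 \<kappa> w^2 - 2 t w - Y = 0; this is its positive root.\<close>
      define w where "w = (t + sqrt (t\<^sup>2 + 2 * \<kappa> * Y)) / (2 * \<kappa>)"
      have "\<bar>t\<bar> < sqrt (t\<^sup>2 + 2 * \<kappa> * Y)" using \<kappa> Y by (intro real_less_rsqrt) auto
      then have w: "w > 0" using \<kappa> by (auto simp: w_def)
      have "(2 * \<kappa> * w - t)\<^sup>2 = t\<^sup>2 + 2 * \<kappa> * Y" using \<kappa> Y by (simp add: w_def)
      then have "2 * \<kappa> * (2 * (\<kappa> * w\<^sup>2 - t * w) - Y) = 0" by (simp add: power2_eq_square algebra_simps)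
      then have "2 * (\<kappa> * w\<^sup>2 - t * w) = Y" using \<kappa> by simp
      then have "\<phi> (2 * ln w) = t" using w by (simp add: \<phi>_def exp_minus field_simps power2_eq_square)
      then show ?thesis by blast
    qed
    then show ?thesis by blast
  qed
  have "(\<lambda>x::real. exp (- x\<^sup>2)) absolutely_integrable_on UNIV \<and> integral UNIV (\<lambda>x::real. exp (- x\<^sup>2)) = sqrt pi"
    using has_bochner_integral_gaussian
    by (auto simp: has_bochner_integral_iff set_integrable_def integrable_completion
        intro!: integral_unique has_integral_integral_lborel[THEN has_integral_eq_rhs])
  \<comment> \<open>Substitution into the Gaussian integral; as \<open>\<phi>'\<close> is positive,
    the absolute value then disappears.\<close>
  then have "(\<lambda>v. \<bar>\<phi>' v\<bar> * exp (- (\<phi> v)\<^sup>2)) absolutely_integrable_on UNIV \<and>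
      integral UNIV (\<lambda>v. \<bar>\<phi>' v\<bar> * exp (- (\<phi> v)\<^sup>2)) = sqrt pi"
    by (subst has_absolute_integral_change_of_variables_1'[OF _ der inj]) (simp_all add: surj)
  then have *: "(\<lambda>v. \<phi>' v * E v) absolutely_integrable_on UNIV" "integral UNIV (\<lambda>v. \<phi>' v * E v) = sqrt pi"
    using pos by (simp_all add: E_def less_imp_le)
  have \<phi>E: "integrable lborel (\<lambda>v. \<phi>' v * E v)"
    using *(1) by (simp add: set_integrable_def integrable_completion)
  have \<phi>E_eq: "(\<integral>v. \<phi>' v * E v \<partial>lborel) = sqrt pi"
    using *(2) integral_lborel[OF \<phi>E] by simp
  have AB: "A v + B v = 2 * (\<phi>' v * E v)" for v
    by (simp add: A_def B_def \<phi>'_def algebra_simps)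
  have nonneg: "A v \<ge> 0" "B v \<ge> 0" for v using \<kappa> Y by (auto simp: A_def B_def E_def)
  have 2: "integrable lborel (\<lambda>v. 2 * (\<phi>' v * E v))" using \<phi>E by simp
  have Ai: "integrable lborel A"
    by (rule Bochner_Integration.integrable_bound[OF 2])
      (use nonneg AB in \<open>auto intro!: AE_I2 simp: abs_of_nonneg simp flip: AB\<close>)
  define c where "c = 2 * ln (Y / (2 * \<kappa>))"
  have refl: "A (c + - 1 * v) = B v" for v
  proof -
    have c: "exp (c / 2) = Y / (2 * \<kappa>)" using \<kappa> Y by (simp add: c_def)
    have "exp ((c - v) / 2) = exp (c / 2) * exp (- (v / 2))"
      unfolding exp_add[symmetric] by (simp add: diff_divide_distrib)
    moreover have "exp (- ((c - v) / 2)) = inverse (exp (c / 2)) * exp (v / 2)"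
      unfolding exp_minus[symmetric] exp_add[symmetric] by (simp add: diff_divide_distrib)
    ultimately have e: "\<kappa> * exp ((c - v) / 2) = Y / 2 * exp (- (v / 2))"
      "Y / 2 * exp (- ((c - v) / 2)) = \<kappa> * exp (v / 2)"
      unfolding c using \<kappa> Y by simp_all
    have "\<phi> (c - v) = - \<phi> v" unfolding \<phi>_def e by simp
    then show ?thesis using e(1) by (simp add: A_def B_def E_def)
  qed
  have Bi: "integrable lborel B"
    using lborel_integrable_real_affine[OF Ai, of "- 1" c] by (simp only: refl)
  have "(\<integral>v. A v \<partial>lborel) = (\<integral>v. B v \<partial>lborel)"
    by (subst lborel_integral_real_affine[of "- 1" _ c]) (simp_all only: refl abs_minus abs_one scaleR_one)
  moreover have "(\<integral>v. A v \<partial>lborel) + (\<integral>v. B v \<partial>lborel) = 2 * sqrt pi"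
    using Bochner_Integration.integral_add[OF Ai Bi] by (simp add: AB \<phi>E_eq)
  ultimately have "has_bochner_integral lborel A (sqrt pi)"
    using Ai by (simp add: has_bochner_integral_iff)
  from has_bochner_integral_mult_right[OF this, of "exp (- \<kappa> * Y) / \<kappa>"]
  have "has_bochner_integral lborel (\<lambda>v. exp (- \<kappa> * Y) / \<kappa> * A v) (sqrt pi / \<kappa> * exp (- \<kappa> * Y))"
    by (simp add: mult_ac)
  also have "(\<lambda>v. exp (- \<kappa> * Y) / \<kappa> * A v) = (\<lambda>v. exp (- (\<kappa>\<^sup>2 * exp v) - Y\<^sup>2 * exp (- v) / 4) * exp (v / 2))"
  proof
    fix v :: real
    have "exp v = (exp (v / 2))\<^sup>2" "exp (- v) = (exp (- (v / 2)))\<^sup>2" "exp (v / 2) * exp (- (v / 2)) = 1"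
      by (simp_all add: power2_eq_square flip: exp_add)
    then have "- (\<kappa>\<^sup>2 * exp v) - Y\<^sup>2 * exp (- v) / 4 = - \<kappa> * Y - (\<phi> v)\<^sup>2"
      unfolding \<phi>_def power2_diff power_mult_distrib by (simp add: power_divide algebra_simps)
    then show "exp (- \<kappa> * Y) / \<kappa> * A v = exp (- (\<kappa>\<^sup>2 * exp v) - Y\<^sup>2 * exp (- v) / 4) * exp (v / 2)"
      using \<kappa> by (simp add: A_def E_def flip: exp_add)
  qed
  finally show ?thesis .
qed

section \<open>Lattice sums of the Green's function\<close>

text \<open>Jacobi's theta transformation: a Gaussian of inverse width \<open>c\<close> sampled at
  spacing \<open>d\<close> turns into a Gaussian in the frequencies \<open>alpha_mode d k\<close>.
  The two summability claims are exported because the integration over \<open>v\<close> needs them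
  pointwise.\<close>

lemma gaussian_theta:
  fixes c d X :: real
  assumes c: "c > 0" and d: "d > 0"
  defines "T \<equiv> \<lambda>k. sqrt (pi / c) / d * exp (- ((alpha_mode d k)\<^sup>2 / (4 * c)))"
  shows "(\<lambda>m::int. exp (- c * (X - d * of_int m)\<^sup>2)) summable_on UNIV" (is ?sum)
    and "T summable_on UNIV" (is ?sumT)
    and "complex_of_real (\<Sum>\<^sub>\<infinity>m::int. exp (- c * (X - d * of_int m)\<^sup>2))
           = (\<Sum>\<^sub>\<infinity>k. of_real (T k) * cis (alpha_mode d k * X))" (is ?eq)
proof -
  \<comment> \<open>With the plus sign the \<open>k\<close>-th Fourier coefficient carries the phase
    cis(\<alpha> X) rather than its conjugate; the reflection m -> -m at the end restores the minus
    sign of the statement.\<close>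
  define g where "g x = complex_of_real (exp (- c * (X + d * x)\<^sup>2))" for x
  \<comment> \<open>From (z + d m)^2 \<ge> d^2 m^2 / 2 - z^2 and m^2 \<ge> |m| for integers, the
    Gaussian is dominated by an exponential in |m|, uniformly for z between X and X + d.\<close>
  define b where "b m = exp (c * (\<bar>X\<bar> + d)\<^sup>2) * exp (- (c * d\<^sup>2 / 2 * \<bar>real_of_int m\<bar>))" for m
  have b: "b summable_on UNIV"
    unfolding b_def using c d by (intro summable_on_cmult_right summable_on_exp_abs_int) simp
  have sq: "(real_of_int m)\<^sup>2 \<ge> \<bar>real_of_int m\<bar>" for m
  proof -
    have "\<bar>m\<bar> * 1 \<le> \<bar>m\<bar> * \<bar>m\<bar>" by (cases "m = 0") (simp, intro mult_left_mono, auto)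
    then have "of_int (\<bar>m\<bar> * 1) \<le> real_of_int (\<bar>m\<bar> * \<bar>m\<bar>)" by (simp only: of_int_le_iff)
    then show ?thesis by (simp add: power2_eq_square)
  qed
  have bound: "norm (g (x + of_int m)) \<le> b m" if x: "x \<in> {0..1}" for m x
  proof -
    define z where "z = X + d * x"
    have "0 \<le> d * x" "d * x \<le> d" using d x by (simp_all add: mult_left_le)
    then have "\<bar>z\<bar> \<le> \<bar>X\<bar> + d" unfolding z_def by linarith
    then have z: "z\<^sup>2 \<le> (\<bar>X\<bar> + d)\<^sup>2"
      using d by (intro abs_le_square_iff[THEN iffD1]) auto
    \<comment> \<open>The parallelogram identity for z + d m and z.\<close>
    have "(d * m)\<^sup>2 + (2 * z + d * m)\<^sup>2 = 2 * (z + d * m)\<^sup>2 + 2 * z\<^sup>2"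
      by (simp add: power2_eq_square algebra_simps)
    then have "(z + d * m)\<^sup>2 \<ge> d\<^sup>2 * (real_of_int m)\<^sup>2 / 2 - z\<^sup>2"
      using zero_le_power2[of "2 * z + d * m"] unfolding power_mult_distrib by linarith
    moreover have "d\<^sup>2 * (real_of_int m)\<^sup>2 \<ge> d\<^sup>2 * \<bar>real_of_int m\<bar>"
      using sq by (intro mult_left_mono) auto
    ultimately have "d\<^sup>2 / 2 * \<bar>real_of_int m\<bar> - (\<bar>X\<bar> + d)\<^sup>2 \<le> (z + d * m)\<^sup>2"
      using z by simp
    from mult_left_mono[OF this, of c]
    have "- c * (z + d * m)\<^sup>2 \<le> c * (\<bar>X\<bar> + d)\<^sup>2 - c * d\<^sup>2 / 2 * \<bar>real_of_int m\<bar>"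
      using c by (simp add: algebra_simps)
    then show ?thesis
      by (simp add: g_def b_def z_def algebra_simps flip: exp_add)
  qed
  have bij: "bij (uminus :: int \<Rightarrow> int)" by (intro bij_betwI[where g = uminus]) auto
  have sum_g: "(\<lambda>m::int. exp (- c * (X + d * of_int m)\<^sup>2)) summable_on UNIV"
    by (rule summable_on_comparison_test[OF b]) (use bound[of 0] in \<open>auto simp: g_def\<close>)
  then show sum: ?sum
    using summable_on_reindex_bij_betw[OF bij, of "\<lambda>m. exp (- c * (X + d * of_int m)\<^sup>2)"] by simp
  have T_nonneg: "T k \<ge> 0" for k using c d by (simp add: T_def)
  show sumT: ?sumT
  proof (rule summable_on_comparison_test)
    show "(\<lambda>k. sqrt (pi / c) / d * exp (- ((2 * pi / d)\<^sup>2 / (4 * c) * \<bar>real_of_int k\<bar>))) summable_on UNIV"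
      using c d by (intro summable_on_cmult_right summable_on_exp_abs_int) simp
    show "T k \<le> sqrt (pi / c) / d * exp (- ((2 * pi / d)\<^sup>2 / (4 * c) * \<bar>real_of_int k\<bar>))" for k
    proof -
      have "(alpha_mode d k)\<^sup>2 / (4 * c) = (2 * pi / d)\<^sup>2 / (4 * c) * (real_of_int k)\<^sup>2"
        by (simp add: alpha_mode_def power_mult_distrib power_divide)
      also have "\<dots> \<ge> (2 * pi / d)\<^sup>2 / (4 * c) * \<bar>real_of_int k\<bar>"
        using sq c by (intro mult_left_mono) auto
      finally show ?thesis unfolding T_def using c d by (intro mult_left_mono) auto
    qed
  qed (use T_nonneg in auto)
  have ft: "(\<integral>x. g x * echar (- k) x \<partial>lborel) = of_real (T k) * cis (alpha_mode d k * X)" for k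
  proof -
    have "g (- X / d + 1 / d * u) * echar (- k) (- X / d + 1 / d * u)
       = cis (alpha_mode d k * X) * (of_real (exp (- c * u\<^sup>2)) * cis (- alpha_mode d k * u))" for u
    proof -
      have "X + d * (- X / d + 1 / d * u) = u" using d by (simp add: field_simps)
      moreover have "2 * pi * of_int (- k) * (- X / d + 1 / d * u) = alpha_mode d k * X + - alpha_mode d k * u"
        using d by (simp add: alpha_mode_def field_simps)
      ultimately show ?thesis unfolding g_def echar_def by (simp only: cis_mult[symmetric] mult_ac)
    qed
    then have "(\<integral>x. g x * echar (- k) x \<partial>lborel) = (1 / d) *\<^sub>R
        (\<integral>u. cis (alpha_mode d k * X) * (of_real (exp (- c * u\<^sup>2)) * cis (- alpha_mode d k * u)) \<partial>lborel)"
      using d by (subst lborel_integral_real_affine[of "1 / d" _ "- X / d"]) auto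
    also have "\<dots> = of_real (T k) * cis (alpha_mode d k * X)"
      using gaussian_fourier_transform[OF c, of "- alpha_mode d k"]
      by (simp add: T_def scaleR_conv_of_real mult_ac)
    finally show ?thesis .
  qed
  have "(\<Sum>\<^sub>\<infinity>m. g (of_int m)) = (\<Sum>\<^sub>\<infinity>k. \<integral>x. g x * echar (- k) x \<partial>lborel)"
  proof (rule poisson_summation[OF _ bound b])
    show "continuous_on UNIV g" unfolding g_def by (intro continuous_intros)
    show "(\<lambda>k. norm (\<integral>x. g x * echar (- k) x \<partial>lborel)) summable_on UNIV"
      using sumT T_nonneg by (simp add: ft norm_mult)
  qed
  also have "(\<Sum>\<^sub>\<infinity>m. g (of_int m)) = (\<Sum>\<^sub>\<infinity>m. g (of_int (- m)))"
    using infsum_reindex_bij_betw[OF bij, of "\<lambda>m. g (of_int m)"] by simp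
  also have "\<dots> = of_real (\<Sum>\<^sub>\<infinity>m::int. exp (- c * (X - d * of_int m)\<^sup>2))"
    using has_sum_of_real[OF has_sum_infsum[OF sum], where 'a = complex] by (intro infsumI) (simp add: g_def)
  finally show ?eq by (simp add: ft)
qed

text \<open>The bound by \<beta> keeps the denominators away from 0, also at \<open>k = 0\<close>;
  the bound linear in |k| supplies the decay over the modes.\<close>

lemma chi_mode_bounds:
  assumes "\<beta> > 0" "d > 0"
  shows "chi_mode d \<beta> k \<ge> \<beta>" and "chi_mode d \<beta> k \<ge> 2 * pi / d * \<bar>of_int k\<bar>" and "chi_mode d \<beta> k > 0"
proof -
  show "chi_mode d \<beta> k \<ge> \<beta>" unfolding chi_mode_def by (rule real_le_rsqrt) simp
  then show "chi_mode d \<beta> k > 0" using assms by linarith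
  show "chi_mode d \<beta> k \<ge> 2 * pi / d * \<bar>of_int k\<bar>"
    unfolding chi_mode_def alpha_mode_def using assms
    by (intro real_le_rsqrt) (simp add: power_mult_distrib power_divide)
qed

lemma chi_mode_sq: "(chi_mode d \<beta> k)\<^sup>2 = (alpha_mode d k)\<^sup>2 + \<beta>\<^sup>2"
  by (simp add: chi_mode_def)

text \<open>\<open>P v\<close> collects the part of the integrand independent of \<open>m\<close>,
  so the theta transformation with \<open>c = exp (- v) / 4\<close> applies for each
  \<open>v\<close>. The mode side is integrated first: its integrals are explicit and their absolute
  values summable, whereas the terms of the lattice side are known only to be nonnegative.\<close>

lemma row_sum_bessel_K_0:
  fixes d \<beta> X Y :: real
  assumes d: "d > 0" and \<beta>: "\<beta> > 0" and Y: "Y > 0"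
  defines "K \<equiv> \<lambda>m::int. 1 / (2 * pi) * bessel_K 0 (\<beta> * sqrt ((X - d * of_int m)\<^sup>2 + Y\<^sup>2))"
    and "W \<equiv> \<lambda>k. exp (- chi_mode d \<beta> k * Y) / (2 * d * chi_mode d \<beta> k)"
  shows "complex_of_real (\<Sum>\<^sub>\<infinity>m. K m) = (\<Sum>\<^sub>\<infinity>k. of_real (W k) * cis (alpha_mode d k * X))"
proof -
  let ?\<chi> = "chi_mode d \<beta>"
  note \<chi> = chi_mode_bounds[OF \<beta> d]
  define P where "P v = exp (- (\<beta>\<^sup>2 * exp v) - Y\<^sup>2 * exp (- v) / 4)" for v
  define h where "h m v = P v * exp (- (exp (- v) / 4) * (X - d * of_int m)\<^sup>2)" for m :: int and v :: real
  \<comment> \<open>The factor \<open>exp (v / 2)\<close> stems from \<open>sqrt (pi / c)\<close>.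
    It turns the \<open>v\<close>-integral from one of order zero into an elementary one of order
    one half.\<close>
  define p where "p k v = 2 * sqrt pi / d * (exp (- ((?\<chi> k)\<^sup>2 * exp v) - Y\<^sup>2 * exp (- v) / 4) * exp (v / 2))" for k v
  define f where "f k v = of_real (p k v) * cis (alpha_mode d k * X)" for k v
  have h_nonneg: "h m v \<ge> 0" and p_nonneg: "p k v \<ge> 0" for m k v
    using d by (auto simp: h_def P_def p_def)
  have [measurable]: "h m \<in> borel_measurable borel" for m
    unfolding h_def P_def by measurable
  have W_nonneg: "W k \<ge> 0" for k using \<chi>[of k] d by (auto simp: W_def)
  have p_eq: "p k v = P v * (sqrt (pi / (exp (- v) / 4)) / d * exp (- ((alpha_mode d k)\<^sup>2 / (4 * (exp (- v) / 4)))))" for k v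
  proof -
    have "exp v = (exp (v / 2))\<^sup>2" by (simp add: power2_eq_square flip: exp_add)
    then have "sqrt (exp v) = exp (v / 2)" by simp
    then have "sqrt (pi / (exp (- v) / 4)) = 2 * sqrt pi * exp (v / 2)"
      by (simp add: exp_minus real_sqrt_mult field_simps)
    moreover have "(alpha_mode d k)\<^sup>2 / (4 * (exp (- v) / 4)) = (alpha_mode d k)\<^sup>2 * exp v"
      by (simp add: exp_minus field_simps)
    ultimately show ?thesis
      by (simp add: p_def P_def chi_mode_sq algebra_simps flip: exp_add)
  qed
  have theta1: "(\<lambda>m. h m v) summable_on UNIV" for v
    unfolding h_def using d by (intro summable_on_cmult_right gaussian_theta(1)) auto
  have theta2: "(\<lambda>k. p k v) summable_on UNIV" for v
    unfolding p_eq using d by (intro summable_on_cmult_right gaussian_theta(2)) auto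
  have theta3: "complex_of_real (\<Sum>\<^sub>\<infinity>m. h m v) = (\<Sum>\<^sub>\<infinity>k. f k v)" for v
  proof -
    have "complex_of_real (\<Sum>\<^sub>\<infinity>m. h m v) =
      of_real (P v) * complex_of_real (\<Sum>\<^sub>\<infinity>m::int. exp (- (exp (- v) / 4) * (X - d * of_int m)\<^sup>2))"
      unfolding h_def by (subst infsum_cmult_right') simp
    also have "\<dots> = (\<Sum>\<^sub>\<infinity>k. f k v)"
      unfolding f_def p_eq using d
      by (subst gaussian_theta(3)) (auto simp: mult.assoc simp flip: infsum_cmult_right')
    finally show ?thesis .
  qed
  \<comment> \<open>The 4 pi will cancel against 1/(2 pi) from the Green's function times 1/2 from
    the Gaussian superposition.\<close>
  have p_int: "has_bochner_integral lborel (p k) (4 * pi * W k)" for k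
  proof -
    have "has_bochner_integral lborel (p k) (2 * sqrt pi / d * (sqrt pi / ?\<chi> k * exp (- ?\<chi> k * Y)))"
      unfolding p_def by (intro has_bochner_integral_mult_right has_bochner_integral_bessel_half \<chi> Y)
    also have "2 * sqrt pi / d * (sqrt pi / ?\<chi> k * exp (- ?\<chi> k * Y)) = 4 * pi * W k"
      using d \<chi>(3)[of k] by (simp add: W_def field_simps)
    finally show ?thesis .
  qed
  have f_int: "integrable lborel (f k)" for k
    unfolding f_def using p_int[of k] by (auto simp: has_bochner_integral_iff)
  have f_norm: "norm (f k v) = p k v" for k v
    using p_nonneg[of k v] by (simp add: f_def norm_mult)
  have W_sum: "W summable_on UNIV"
  proof (rule summable_on_comparison_test)
    show "(\<lambda>k. 1 / (2 * d * \<beta>) * exp (- (2 * pi / d * Y * \<bar>real_of_int k\<bar>))) summable_on UNIV"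
      using d Y by (intro summable_on_cmult_right summable_on_exp_abs_int) simp
    show "W k \<le> 1 / (2 * d * \<beta>) * exp (- (2 * pi / d * Y * \<bar>real_of_int k\<bar>))" for k
    proof -
      have "2 * pi / d * \<bar>real_of_int k\<bar> * Y \<le> ?\<chi> k * Y" using \<chi>(2)[of k] Y by (intro mult_right_mono) auto
      then have "exp (- ?\<chi> k * Y) \<le> exp (- (2 * pi / d * Y * \<bar>real_of_int k\<bar>))" by (simp add: mult_ac)
      moreover have "2 * d * \<beta> \<le> 2 * d * ?\<chi> k" using d \<chi>(1)[of k] by simp
      ultimately show ?thesis
        unfolding W_def using d \<beta> by (simp add: frac_le)
    qed
  qed (use W_nonneg in auto)
  have f_sum: "(\<lambda>k. \<integral>v. norm (f k v) \<partial>lborel) summable_on UNIV"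
    using p_int W_sum by (simp add: f_norm has_bochner_integral_iff summable_on_cmult_right)
  have f_abs: "(\<lambda>k. norm (f k v)) summable_on UNIV" for v
    using theta2 by (simp add: f_norm)
  note swap = has_sum_integral[of "UNIV :: int set" lborel f, OF _ _ f_int f_sum f_abs]
  define H where "H v = (\<Sum>\<^sub>\<infinity>m. h m v)" for v
  have H_int': "integrable lborel (\<lambda>v. complex_of_real (H v))"
    using swap(1) by (simp add: H_def theta3)
  then have H_int: "integrable lborel H" by (simp add: complex_of_real_integrable_eq)
  have f_val: "(\<integral>v. f k v \<partial>lborel) = 4 * pi * (of_real (W k) * cis (alpha_mode d k * X))" for k
    using p_int[of k] by (simp add: f_def has_bochner_integral_iff)
  have "((\<lambda>k. 4 * pi * (of_real (W k) * cis (alpha_mode d k * X))) has_sum complex_of_real (\<integral>v. H v \<partial>lborel)) UNIV"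
    using swap(2) by (simp add: f_val H_def flip: theta3)
  from has_sum_cmult_right[OF this, of "of_real (1 / (4 * pi))"]
  have *: "((\<lambda>k. of_real (W k) * cis (alpha_mode d k * X)) has_sum complex_of_real (1 / (4 * pi) * (\<integral>v. H v \<partial>lborel))) UNIV"
    by simp
  \<comment> \<open>The positive series \<open>H\<close> is integrable by its other expansion, which dominates each \<open>h m\<close>
    and the partial sums of the integrals, so no estimate of \<open>K\<^sub>0\<close> is needed.\<close>
  have h_le: "(\<Sum>m\<in>J. h m v) \<le> H v" if "finite J" for J v
    unfolding H_def using that theta1 h_nonneg by (intro finite_sum_le_infsum) auto
  have h_int: "integrable lborel (h m)" for m
    by (rule Bochner_Integration.integrable_bound[OF H_int])
      (use h_le[of "{m}"] h_nonneg in \<open>auto intro!: AE_I2 order_trans[OF _ abs_ge_self] simp: abs_of_nonneg\<close>)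
  have h_sum: "(\<lambda>m. \<integral>v. norm (h m v) \<partial>lborel) summable_on UNIV"
  proof (rule nonneg_bdd_above_summable_on)
    show "bdd_above (sum (\<lambda>m. \<integral>v. norm (h m v) \<partial>lborel) ` {F. F \<subseteq> UNIV \<and> finite F})"
    proof (rule bdd_aboveI2)
      fix J :: "int set" assume "J \<in> {F. F \<subseteq> UNIV \<and> finite F}"
      then have J: "finite J" by simp
      have "(\<Sum>m\<in>J. \<integral>v. norm (h m v) \<partial>lborel) = (\<integral>v. (\<Sum>m\<in>J. h m v) \<partial>lborel)"
        using h_int h_nonneg by (subst Bochner_Integration.integral_sum) auto
      also have "\<dots> \<le> (\<integral>v. H v \<partial>lborel)"
        using h_int H_int h_le[OF J] by (intro integral_mono) auto
      finally show "(\<Sum>m\<in>J. \<integral>v. norm (h m v) \<partial>lborel) \<le> (\<integral>v. H v \<partial>lborel)" .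
    qed
  qed simp
  have "((\<lambda>m. \<integral>v. h m v \<partial>lborel) has_sum (\<integral>v. H v \<partial>lborel)) UNIV"
    unfolding H_def using theta1 h_nonneg by (intro has_sum_integral(2) h_int h_sum) auto
  from has_sum_cmult_right[OF this, of "1 / (4 * pi)"]
  have "(K has_sum (1 / (4 * pi) * (\<integral>v. H v \<partial>lborel))) UNIV"
  proof (rule has_sum_cong[THEN iffD1, rotated])
    fix m
    define r where "r = sqrt ((X - d * of_int m)\<^sup>2 + Y\<^sup>2)"
    have r: "r > 0" using Y by (auto simp: r_def intro: add_nonneg_pos)
    have "h m = (\<lambda>v. exp (- (\<beta>\<^sup>2 * exp v) - r\<^sup>2 * exp (- v) / 4))"
      by (rule ext) (simp add: h_def P_def r_def algebra_simps add_divide_distrib flip: exp_add)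
    with bessel_K_0_integral_exp[OF \<beta> r] h_int[of m]
    have eq: "bessel_K 0 (\<beta> * r) = 1 / 2 * (\<integral>v. h m v \<partial>lborel)" by simp
    show "1 / (4 * pi) * (\<integral>v. h m v \<partial>lborel) = K m"
      unfolding K_def r_def[symmetric] eq by simp
  qed
  with * show ?thesis by (simp add: infsumI)
qed

lemma row_sum_green:
  fixes t s :: "real \<times> real"
  assumes d: "d > 0" and \<beta>: "\<beta> > 0" and Y: "of_int n * \<eta> - (snd t - snd s) > 0"
  shows "complex_of_real (\<Sum>\<^sub>\<infinity>m. green \<beta> t (s + lattice_vec d \<xi> \<eta> m n)) =
    (\<Sum>\<^sub>\<infinity>k. of_real (exp (- chi_mode d \<beta> k * (of_int n * \<eta> - (snd t - snd s))) / (2 * d * chi_mode d \<beta> k))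
       * cis (alpha_mode d k * (fst t - fst s - of_int n * \<xi>)))"
proof -
  have "norm (t - (s + lattice_vec d \<xi> \<eta> m n))
      = sqrt ((fst t - fst s - of_int n * \<xi> - d * of_int m)\<^sup>2 + (of_int n * \<eta> - (snd t - snd s))\<^sup>2)" for m
    by (simp add: norm_prod_def lattice_vec_def vec_e1_def vec_e2_def algebra_simps power2_commute)
  then show ?thesis
    unfolding green_def by (simp only: row_sum_bessel_K_0[OF d \<beta> Y])
qed

section \<open>Summation over the rows\<close>

lemma unit_cell_snd_diff:
  assumes "t \<in> unit_cell d \<xi> \<eta>" "s \<in> unit_cell d \<xi> \<eta>" and "\<eta> > 0"
  shows "\<bar>snd t - snd s\<bar> \<le> \<eta>"
proof -
  have "\<bar>snd u\<bar> \<le> \<eta> / 2" if "u \<in> unit_cell d \<xi> \<eta>" for u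
  proof -
    obtain x1 x2 where u: "u = x1 *\<^sub>R vec_e1 d + x2 *\<^sub>R vec_e2 \<xi> \<eta>" "x2 \<in> {-1/2..1/2}"
      using \<open>u \<in> _\<close> unfolding unit_cell_def by blast
    then have x2: "snd u = x2 * \<eta>" by (simp add: vec_e1_def vec_e2_def)
    have "\<bar>x2\<bar> * \<eta> \<le> 1 / 2 * \<eta>" using u(2) \<open>\<eta> > 0\<close> by (intro mult_right_mono) auto
    then show ?thesis using \<open>\<eta> > 0\<close> x2 by (simp add: abs_mult)
  qed
  from this[OF assms(1)] this[OF assms(2)] show ?thesis by linarith
qed

lemma norm_exp_minus_cnj_Q_mode:
  "norm (exp (- cnj (Q_mode d \<xi> \<eta> \<beta> k))) = exp (- (chi_mode d \<beta> k * \<eta>))"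
  by (simp add: Q_mode_def)

text \<open>The contribution of one mode to one entry of the triple matrix product, with the target
  and source exponentials merged. It is also what summing that mode over all rows produces, so it
  links the analysis to the matrices.\<close>

definition mode_term :: "real \<Rightarrow> real \<Rightarrow> real \<Rightarrow> real \<Rightarrow> real \<times> real \<Rightarrow> real \<times> real \<Rightarrow> int \<Rightarrow> complex" where
  "mode_term d \<xi> \<eta> \<beta> t s k =
     of_real (exp (chi_mode d \<beta> k * (snd t - snd s)) / (2 * d * chi_mode d \<beta> k))
     * cis (alpha_mode d k * (fst t - fst s))
     * (exp (- 2 * cnj (Q_mode d \<xi> \<eta> \<beta> k)) / (1 - exp (- cnj (Q_mode d \<xi> \<eta> \<beta> k))))"

text \<open>The double series over rows and modes converges absolutely, because n \<eta> - y \<ge>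
  (n - 1) \<eta> for every row. Its order of summation may be exchanged, and for a fixed mode the
  rows form a geometric series with ratio exp(-cnj Q), starting at the second power.\<close>

lemma K2_north_eq_mode_sum:
  fixes t s :: "real \<times> real"
  assumes d: "d > 0" and \<beta>: "\<beta> > 0" and \<eta>: "\<eta> > 0" and y: "\<bar>snd t - snd s\<bar> \<le> \<eta>"
  shows "(mode_term d \<xi> \<eta> \<beta> t s has_sum complex_of_real (K2_north d \<xi> \<eta> \<beta> t s)) UNIV"
proof -
  let ?\<chi> = "chi_mode d \<beta>" and ?\<alpha> = "alpha_mode d"
  note \<chi> = chi_mode_bounds[OF \<beta> d]
  define x where "x = fst t - fst s"
  define y where "y = snd t - snd s"
  have y: "\<bar>y\<bar> \<le> \<eta>" using assms by (simp add: y_def)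
  define a where "a n k = of_real (exp (- ?\<chi> k * (of_int n * \<eta> - y)) / (2 * d * ?\<chi> k)) * cis (?\<alpha> k * (x - of_int n * \<xi>))" for n k :: int
  define z where "z k = exp (- cnj (Q_mode d \<xi> \<eta> \<beta> k))" for k
  have z: "norm (z k) < 1" for k
    unfolding z_def norm_exp_minus_cnj_Q_mode using \<chi>(3)[of k] \<eta> by simp
  have rows: "complex_of_real (\<Sum>\<^sub>\<infinity>m. green \<beta> t (s + lattice_vec d \<xi> \<eta> m n)) = (\<Sum>\<^sub>\<infinity>k. a n k)"
    if n: "n \<ge> 2" for n
  proof -
    have "2 * \<eta> \<le> of_int n * \<eta>" using n \<eta> by (intro mult_right_mono) auto
    then have "of_int n * \<eta> - (snd t - snd s) > 0" using abs_le_D1[OF y] \<eta> unfolding y_def by linarith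
    from row_sum_green[OF d \<beta> this] show ?thesis by (simp add: a_def x_def y_def)
  qed
  have a_norm: "norm (a n k) = exp (- ?\<chi> k * (of_int n * \<eta> - y)) / (2 * d * ?\<chi> k)" for n k
    unfolding a_def norm_mult norm_of_real norm_cis using d \<chi>(3)[of k] by (simp add: abs_mult)
  \<comment> \<open>Averaging the two lower bounds for \<open>chi_mode\<close> spends one half on
    decay in \<open>n\<close> and the other on decay in \<open>k\<close>, so the majorant is a
    product of two summable sequences.\<close>
  have a_le: "norm (a n k) \<le> exp (- (\<beta> * \<eta> / 2)* (of_int n - 1)) * (1 / (2 * d * \<beta>) * exp (- (pi / d * \<eta> * \<bar>of_int k\<bar>)))"
    if n: "n \<ge> 2" for n k
  proof -
    have n1: "real_of_int n - 1 \<ge> 1" using n by simp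
    have "?\<chi> k * \<eta> * (of_int n - 1) \<ge> \<beta> * \<eta> * (of_int n - 1)"
      using \<chi>(1)[of k] \<eta> n1 by (intro mult_right_mono) auto
    moreover have "?\<chi> k * \<eta> * (of_int n - 1) \<ge> (2 * pi / d * \<bar>of_int k\<bar>) * \<eta> * 1"
      using \<chi>(2)[of k] \<chi>(3)[of k] \<eta> n1 d by (intro mult_mono mult_right_mono) auto
    moreover have "?\<chi> k * (of_int n * \<eta> - y) \<ge> ?\<chi> k * (\<eta> * (of_int n - 1))"
      using y \<chi>(3)[of k] by (intro mult_left_mono) (auto simp: algebra_simps)
    ultimately have "\<beta> * \<eta> / 2 * (of_int n - 1) + pi / d * \<eta> * \<bar>of_int k\<bar> \<le> ?\<chi> k * (of_int n * \<eta> - y)"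
      by (simp add: field_simps)
    then have "exp (- ?\<chi> k * (of_int n * \<eta> - y)) \<le> exp (- (\<beta> * \<eta> / 2)* (of_int n - 1)) * exp (- (pi / d * \<eta> * \<bar>of_int k\<bar>))"
      by (simp flip: exp_add)
    moreover have "2 * d * \<beta> \<le> 2 * d * ?\<chi> k" using d \<chi>(1)[of k] by simp
    ultimately have "exp (- ?\<chi> k * (of_int n * \<eta> - y)) / (2 * d * ?\<chi> k)
       \<le> exp (- (\<beta> * \<eta> / 2)* (of_int n - 1)) * exp (- (pi / d * \<eta> * \<bar>of_int k\<bar>)) / (2 * d * \<beta>)"
      using d \<beta> by (intro frac_le) auto
    then show ?thesis by (simp add: a_norm)
  qed
  have bij: "bij_betw (\<lambda>i. int i + 2) UNIV {2..}"
    by (intro bij_betwI[where g = "\<lambda>n. nat (n - 2)"]) auto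
  have rows_sum: "(\<lambda>n::int. exp (- (\<beta> * \<eta> / 2)* (of_int n - 1))) summable_on {2..}"
  proof -
    have "(\<lambda>n::int. exp (\<beta> * \<eta> / 2) * exp (- (\<beta> * \<eta> / 2 * \<bar>of_int n\<bar>))) summable_on UNIV"
      using \<beta> \<eta> by (intro summable_on_cmult_right summable_on_exp_abs_int) simp
    then have "(\<lambda>n::int. exp (\<beta> * \<eta> / 2) * exp (- (\<beta> * \<eta> / 2 * \<bar>of_int n\<bar>))) summable_on {2..}"
      by (rule summable_on_subset_banach) simp
    then show ?thesis
      by (rule summable_on_cong[THEN iffD1, rotated]) (simp add: field_simps flip: exp_add)
  qed
  have cols_sum: "(\<lambda>k::int. 1 / (2 * d * \<beta>) * exp (- (pi / d * \<eta> * \<bar>of_int k\<bar>))) summable_on UNIV"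
    using d \<eta> by (intro summable_on_cmult_right summable_on_exp_abs_int) simp
  have "(\<lambda>(n, k). exp (- (\<beta> * \<eta> / 2)* (of_int n - 1)) * (1 / (2 * d * \<beta>) * exp (- (pi / d * \<eta> * \<bar>of_int k\<bar>))))
      summable_on ({2::int..} \<times> (UNIV :: int set))"
  proof (rule summable_on_SigmaI[OF _ summable_on_cmult_left[OF rows_sum]])
    fix n :: int
    from has_sum_cmult_right[OF has_sum_infsum[OF cols_sum], of "exp (- (\<beta> * \<eta> / 2) * (of_int n - 1))"]
    show "((\<lambda>k. case (n, k) of (n, k) \<Rightarrow> exp (- (\<beta> * \<eta> / 2) * (of_int n - 1)) *
        (1 / (2 * d * \<beta>) * exp (- (pi / d * \<eta> * \<bar>of_int k\<bar>)))) has_sum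
        exp (- (\<beta> * \<eta> / 2) * (of_int n - 1)) *
        (\<Sum>\<^sub>\<infinity>k::int. 1 / (2 * d * \<beta>) * exp (- (pi / d * \<eta> * \<bar>of_int k\<bar>)))) UNIV"
      by simp
  qed (use d \<beta> in auto)
  then have "(\<lambda>(n, k). norm (a n k)) summable_on ({2..} \<times> UNIV)"
    by (rule summable_on_comparison_test) (use a_le in auto)
  then have a_sum: "(\<lambda>(n, k). a n k) summable_on ({2..} \<times> UNIV)"
    by (rule abs_summable_summable[OF summable_on_cong[THEN iffD1, rotated]]) auto
  have geom: "((\<lambda>n. a n k) has_sum mode_term d \<xi> \<eta> \<beta> t s k) {2..}" for k
  proof -
    have pow: "a (int i + 2) k = of_real (exp (?\<chi> k * y) / (2 * d * ?\<chi> k)) * cis (?\<alpha> k * x) * (z k ^ 2 * z k ^ i)" for i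
    proof -
      have "z k ^ (2 + i) = exp (of_nat (2 + i) * - cnj (Q_mode d \<xi> \<eta> \<beta> k))"
        unfolding z_def by (rule exp_of_nat_mult[symmetric])
      also have "of_nat (2 + i) * - cnj (Q_mode d \<xi> \<eta> \<beta> k) =
          of_real (- ?\<chi> k * (of_int (int i + 2) * \<eta>)) + \<i> * of_real (- ?\<alpha> k * (of_int (int i + 2) * \<xi>))"
        by (simp add: Q_mode_def algebra_simps)
      also have "exp \<dots> = of_real (exp (- ?\<chi> k * (of_int (int i + 2) * \<eta>))) * cis (- ?\<alpha> k * (of_int (int i + 2) * \<xi>))"
        by (simp only: exp_add exp_of_real cis_conv_exp)
      finally have "z k ^ 2 * z k ^ i = of_real (exp (- ?\<chi> k * (of_int (int i + 2) * \<eta>))) * cis (- ?\<alpha> k * (of_int (int i + 2) * \<xi>))"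
        by (simp only: power_add)
      moreover have "exp (- ?\<chi> k * (of_int (int i + 2) * \<eta> - y)) = exp (?\<chi> k * y) * exp (- ?\<chi> k * (of_int (int i + 2) * \<eta>))"
        by (simp add: algebra_simps flip: exp_add)
      moreover have "cis (?\<alpha> k * (x - of_int (int i + 2) * \<xi>)) = cis (?\<alpha> k * x) * cis (- ?\<alpha> k * (of_int (int i + 2) * \<xi>))"
        unfolding cis_mult by (simp add: algebra_simps)
      ultimately show ?thesis unfolding a_def by simp
    qed
    have "((\<lambda>i. z k ^ i) has_sum (1 / (1 - z k))) UNIV"
      using z[of k] by (intro norm_summable_imp_has_sum geometric_sums) (auto simp: norm_power)
    then have "((\<lambda>i. a (int i + 2) k) has_sum
        of_real (exp (?\<chi> k * y) / (2 * d * ?\<chi> k)) * cis (?\<alpha> k * x) * (z k ^ 2 * (1 / (1 - z k)))) UNIV"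
      unfolding pow by (intro has_sum_cmult_right)
    also have "z k ^ 2 = exp (- 2 * cnj (Q_mode d \<xi> \<eta> \<beta> k))"
      by (simp add: z_def flip: exp_double)
    finally show ?thesis
      unfolding has_sum_reindex_bij_betw[OF bij, of "\<lambda>n. a n k"]
      by (simp add: mode_term_def x_def y_def z_def)
  qed
  have "((\<lambda>(k, n). a n k) has_sum (\<Sum>\<^sub>\<infinity>(n, k)\<in>{2..} \<times> UNIV. a n k)) (UNIV \<times> {2..})"
    using has_sum_swap[THEN iffD1, OF has_sum_infsum[OF a_sum]] by simp
  from has_sum_SigmaD[OF this] geom
  have 1: "(mode_term d \<xi> \<eta> \<beta> t s has_sum (\<Sum>\<^sub>\<infinity>(n, k)\<in>{2..} \<times> UNIV. a n k)) UNIV"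
    by simp
  have "((\<lambda>n. \<Sum>\<^sub>\<infinity>k. a n k) has_sum (\<Sum>\<^sub>\<infinity>(n, k)\<in>{2..} \<times> UNIV. a n k)) {2..}"
  proof (rule has_sum_SigmaD[OF has_sum_infsum[OF a_sum]])
    fix n :: int assume "n \<in> {2..}"
    then show "((\<lambda>k. case (n, k) of (n, k) \<Rightarrow> a n k) has_sum (\<Sum>\<^sub>\<infinity>k. a n k)) UNIV"
      using summable_on_SigmaD1[OF a_sum, of n] by (simp add: has_sum_infsum)
  qed
  then have 2: "((\<lambda>n. complex_of_real (\<Sum>\<^sub>\<infinity>m. green \<beta> t (s + lattice_vec d \<xi> \<eta> m n))) has_sum
      (\<Sum>\<^sub>\<infinity>(n, k)\<in>{2..} \<times> UNIV. a n k)) {2..}"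
    by (rule has_sum_cong[THEN iffD1, rotated]) (simp add: rows)
  \<comment> \<open>\<open>K2_north\<close> is a real infinite sum while the modes are complex.
    Taking real parts shows that the real series converges; embedding it back and using uniqueness
    identifies the two values.\<close>
  have "((\<lambda>n. \<Sum>\<^sub>\<infinity>m. green \<beta> t (s + lattice_vec d \<xi> \<eta> m n)) has_sum
      Re (\<Sum>\<^sub>\<infinity>(n, k)\<in>{2..} \<times> UNIV. a n k)) {2..}"
    using has_sum_Re[OF 2] unfolding Re_complex_of_real .
  moreover from infsumI[OF this] have "K2_north d \<xi> \<eta> \<beta> t s = Re (\<Sum>\<^sub>\<infinity>(n, k)\<in>{2..} \<times> UNIV. a n k)"
    unfolding K2_north_def .
  ultimately have "((\<lambda>n. \<Sum>\<^sub>\<infinity>m. green \<beta> t (s + lattice_vec d \<xi> \<eta> m n)) has_sum K2_north d \<xi> \<eta> \<beta> t s) {2..}"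
    by (simp only:)
  from has_sum_unique[OF has_sum_of_real[OF this] 2] 1 show ?thesis by (simp only:)
qed

section \<open>The factorization\<close>

text \<open>The growth exp(\<chi> (y - y')) is at most exp(\<chi> \<eta>) and uses up one of the two
  factors exp(-\<chi> \<eta>) from exp(-2 cnj Q); the other gives the geometric decay. The
  denominator is bounded below by the reverse triangle inequality and \<chi> \<ge> \<beta>.\<close>

lemma norm_mode_term_le:
  assumes d: "d > 0" and \<beta>: "\<beta> > 0" and \<eta>: "\<eta> > 0" and y: "\<bar>snd t - snd s\<bar> \<le> \<eta>"
  shows "norm (mode_term d \<xi> \<eta> \<beta> t s k)
    \<le> 1 / (2 * d * \<beta> * (1 - exp (- \<beta> * \<eta>))) * exp (- 2 * pi * \<eta> / d) ^ nat \<bar>k\<bar>"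
proof -
  define c where "c = chi_mode d \<beta> k"
  define z where "z = exp (- cnj (Q_mode d \<xi> \<eta> \<beta> k))"
  have c: "c \<ge> \<beta>" "c \<ge> 2 * pi / d * \<bar>of_int k\<bar>" "c > 0"
    using chi_mode_bounds[OF \<beta> d, of k] by (simp_all add: c_def)
  have z: "norm z = exp (- (c * \<eta>))" unfolding z_def norm_exp_minus_cnj_Q_mode c_def ..
  have "exp (- (c * \<eta>)) \<le> exp (- \<beta> * \<eta>)" using c(1) \<eta> by simp
  then have "1 - exp (- \<beta> * \<eta>) \<le> 1 - norm z" by (simp add: z)
  also have "\<dots> \<le> norm (1 - z)" using norm_triangle_ineq2[of 1 z] by simp
  finally have den: "1 - exp (- \<beta> * \<eta>) \<le> norm (1 - z)" .
  have pos: "1 - exp (- \<beta> * \<eta>) > 0" using \<beta> \<eta> by simp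
  have "exp (- 2 * cnj (Q_mode d \<xi> \<eta> \<beta> k)) = z ^ 2"
    by (simp add: z_def flip: exp_double)
  then have "norm (mode_term d \<xi> \<eta> \<beta> t s k)
      = exp (c * (snd t - snd s)) / (2 * d * c) * (exp (- (c * \<eta>)) ^ 2 / norm (1 - z))"
    using c(3) d unfolding mode_term_def c_def[symmetric] z_def[symmetric]
    by (simp add: norm_mult norm_divide norm_power z)
  also have "\<dots> = exp (c * (snd t - snd s) - 2 * (c * \<eta>)) / (2 * d * c * norm (1 - z))"
  proof -
    have "exp (c * (snd t - snd s) - 2 * (c * \<eta>)) = exp (c * (snd t - snd s)) * exp (- (c * \<eta>)) ^ 2"
      unfolding power2_eq_square exp_add[symmetric] by simp
    then show ?thesis by simp
  qed
  also have "\<dots> \<le> exp (- 2 * pi * \<eta> / d) ^ nat \<bar>k\<bar> / (2 * d * \<beta> * (1 - exp (- \<beta> * \<eta>)))"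
  proof (rule frac_le)
    have "c * (snd t - snd s) \<le> c * \<eta>" using y c(3) by (intro mult_left_mono) auto
    moreover have "2 * pi / d * \<bar>of_int k\<bar> * \<eta> \<le> c * \<eta>" using c(2) \<eta> by (intro mult_right_mono) auto
    ultimately have "c * (snd t - snd s) - 2 * (c * \<eta>) \<le> of_nat (nat \<bar>k\<bar>) * (- 2 * pi * \<eta> / d)"
      by (simp add: mult_ac)
    then show "exp (c * (snd t - snd s) - 2 * (c * \<eta>)) \<le> exp (- 2 * pi * \<eta> / d) ^ nat \<bar>k\<bar>"
      unfolding exp_of_nat_mult[symmetric] by simp
    show "2 * d * \<beta> * (1 - exp (- \<beta> * \<eta>)) \<le> 2 * d * c * norm (1 - z)"
      using c \<beta> d pos den by (intro mult_mono) auto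
  qed (use d \<beta> pos in auto)
  finally show ?thesis by (simp add: mult_ac)
qed

text \<open>The definition of the truncation order solved for the power. Replacing the ceiling by a
  natural number can only increase it, so the inequality survives even where the logarithm is
  negative.\<close>

lemma trunc_order_tail:
  assumes d: "d > 0" and \<eta>: "\<eta> > 0" and \<epsilon>: "\<epsilon> > 0"
  shows "exp (- 2 * pi * \<eta> / d) ^ trunc_order d \<eta> \<epsilon> \<le> (1 - exp (- 2 * pi * \<eta> / d)) * \<epsilon>"
proof -
  define q where "q = exp (- 2 * pi * \<eta> / d)"
  have q: "0 < q" "q < 1" using d \<eta> by (auto simp: q_def)
  have "d / (2 * pi * \<eta>) * ln (1 / (1 - q) * (1 / \<epsilon>)) \<le> of_nat (trunc_order d \<eta> \<epsilon>)"
    unfolding trunc_order_def q_def by (rule real_nat_ceiling_ge)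
  then have "ln (1 / (1 - q) * (1 / \<epsilon>)) \<le> of_nat (trunc_order d \<eta> \<epsilon>) * (2 * pi * \<eta> / d)"
    using d \<eta> by (simp add: field_simps)
  moreover have "ln (1 / (1 - q) * (1 / \<epsilon>)) = - ln ((1 - q) * \<epsilon>)"
    using q \<epsilon> by (simp add: ln_mult ln_div)
  ultimately have "of_nat (trunc_order d \<eta> \<epsilon>) * (- 2 * pi * \<eta> / d) \<le> ln ((1 - q) * \<epsilon>)"
    by simp
  then have "exp (of_nat (trunc_order d \<eta> \<epsilon>) * (- 2 * pi * \<eta> / d)) \<le> (1 - q) * \<epsilon>"
    using q \<epsilon> by (subst ln_ge_iff[symmetric]) auto
  then show ?thesis unfolding exp_of_nat_mult q_def .
qed

section \<open>Matrix entries and the error bound\<close>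

lemma mult_mat_entry:
  fixes A B :: "'a :: semiring_0 mat"
  assumes "A \<in> carrier_mat nr n" "B \<in> carrier_mat n nc" "i < nr" "j < nc"
  shows "(A * B) $$ (i, j) = (\<Sum>k<n. A $$ (i, k) * B $$ (k, j))"
  using assms by (simp add: scalar_prod_def lessThan_atLeast0)

text \<open>The diagonal factor collapses the two inner summations into one, and the index shift by
  \<open>M\<close> turns column numbers into modes. Conjugating \<open>D_south\<close> entrywise
  replaces \<open>Q_mode\<close> by its conjugate.\<close>

lemma LDR_entry:
  assumes "l < NT" "j < NS"
  shows "(L_north d \<beta> M NT t * D_north d \<xi> \<eta> \<beta> M * R_north d \<beta> M NS s) $$ (l, j)
    = (\<Sum>k\<in>{- int M..int M}. mode_term d \<xi> \<eta> \<beta> (t l) (s j) k)"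
proof -
  have D: "D_north d \<xi> \<eta> \<beta> M \<in> carrier_mat (2 * M + 1) (2 * M + 1)"
    by (simp add: D_north_def D_south_def)
  have L: "L_north d \<beta> M NT t \<in> carrier_mat NT (2 * M + 1)" by (simp add: L_north_def)
  have R: "R_north d \<beta> M NS s \<in> carrier_mat (2 * M + 1) NS" by (simp add: R_north_def)
  have LD: "(L_north d \<beta> M NT t * D_north d \<xi> \<eta> \<beta> M) $$ (l, k) =
      L_north d \<beta> M NT t $$ (l, k) * D_north d \<xi> \<eta> \<beta> M $$ (k, k)" if k: "k < 2 * M + 1" for k
  proof -
    have "(L_north d \<beta> M NT t * D_north d \<xi> \<eta> \<beta> M) $$ (l, k)
        = (\<Sum>i<2 * M + 1. L_north d \<beta> M NT t $$ (l, i) * D_north d \<xi> \<eta> \<beta> M $$ (i, k))"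
      using mult_mat_entry[OF L D assms(1) k] .
    also have "\<dots> = (\<Sum>i<2 * M + 1. if i = k then L_north d \<beta> M NT t $$ (l, k) * D_north d \<xi> \<eta> \<beta> M $$ (k, k) else 0)"
      using k by (intro sum.cong) (auto simp: D_north_def D_south_def)
    finally show ?thesis using k by simp
  qed
  have "(L_north d \<beta> M NT t * D_north d \<xi> \<eta> \<beta> M * R_north d \<beta> M NS s) $$ (l, j)
     = (\<Sum>k<2 * M + 1. (L_north d \<beta> M NT t * D_north d \<xi> \<eta> \<beta> M) $$ (l, k) * R_north d \<beta> M NS s $$ (k, j))"
    using mult_mat_entry[OF mult_carrier_mat[OF L D] R assms] .
  also have "\<dots> = (\<Sum>k<2 * M + 1. mode_term d \<xi> \<eta> \<beta> (t l) (s j) (mode M k))"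
  proof (rule sum.cong)
    fix k assume "k \<in> {..<2 * M + 1}"
    then have k: "k < 2 * M + 1" by simp
    define m where "m = mode M k"
    have "L_north d \<beta> M NT t $$ (l, k) = of_real (exp (chi_mode d \<beta> m * snd (t l))) * cis (alpha_mode d m * fst (t l))"
      using k assms by (simp add: L_north_def m_def case_prod_unfold Let_def cis_conv_exp flip: exp_of_real)
    moreover have "R_north d \<beta> M NS s $$ (k, j) = of_real (exp (- (chi_mode d \<beta> m * snd (s j)))) * cis (- (alpha_mode d m * fst (s j)))"
      using k assms by (simp add: R_north_def m_def case_prod_unfold Let_def cis_conv_exp flip: exp_of_real)
    moreover have "D_north d \<xi> \<eta> \<beta> M $$ (k, k) = 1 / of_real (2 * d * chi_mode d \<beta> m) *
        (exp (- 2 * cnj (Q_mode d \<xi> \<eta> \<beta> m)) / (1 - exp (- cnj (Q_mode d \<xi> \<eta> \<beta> m))))"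
      using k by (simp add: D_north_def D_south_def m_def Let_def exp_cnj)
    moreover have "exp (chi_mode d \<beta> m * (snd (t l) - snd (s j))) =
        exp (chi_mode d \<beta> m * snd (t l)) * exp (- (chi_mode d \<beta> m * snd (s j)))"
      by (simp add: algebra_simps flip: exp_add)
    moreover have "cis (alpha_mode d m * (fst (t l) - fst (s j))) =
        cis (alpha_mode d m * fst (t l)) * cis (- (alpha_mode d m * fst (s j)))"
      unfolding cis_mult by (simp add: algebra_simps)
    ultimately show "(L_north d \<beta> M NT t * D_north d \<xi> \<eta> \<beta> M) $$ (l, k) * R_north d \<beta> M NS s $$ (k, j)
        = mode_term d \<xi> \<eta> \<beta> (t l) (s j) (mode M k)"
      unfolding LD[OF k] mode_term_def m_def[symmetric] by simp
  qed simp
  also have "\<dots> = (\<Sum>k\<in>{- int M..int M}. mode_term d \<xi> \<eta> \<beta> (t l) (s j) k)"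
    by (rule sum.reindex_bij_witness[of _ "\<lambda>m. nat (m + int M)" "mode M"]) (auto simp: mode_def)
  finally show ?thesis .
qed

theorem corollary1:
  fixes d \<xi> \<eta> \<beta> :: real
  assumes "d > 0" and "\<eta> > 0" and "d \<ge> sqrt (\<xi>\<^sup>2 + \<eta>\<^sup>2)" and "\<beta> > 0"
  shows "\<exists>C::real. \<forall>(\<epsilon>::real) (NT::nat) (NS::nat) (t :: nat \<Rightarrow> real \<times> real) (s :: nat \<Rightarrow> real \<times> real) (M::nat).
           0 < \<epsilon> \<longrightarrow> \<epsilon> < 1 \<longrightarrow>
           (\<forall>l<NT. t l \<in> unit_cell d \<xi> \<eta>) \<longrightarrow>
           (\<forall>j<NS. s j \<in> unit_cell d \<xi> \<eta>) \<longrightarrow>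
           M = trunc_order d \<eta> \<epsilon> \<longrightarrow>
           (\<exists>E \<in> carrier_mat NT NS.
              (\<forall>l<NT. \<forall>j<NS. cmod (E $$ (l, j)) \<le> C * \<epsilon>) \<and>
              P2_north d \<xi> \<eta> \<beta> NT NS t s =
                L_north d \<beta> M NT t * D_north d \<xi> \<eta> \<beta> M * R_north d \<beta> M NS s + E)"
proof -
  define q where "q = exp (- 2 * pi * \<eta> / d)"
  \<comment> \<open>\<open>A\<close> is the prefactor of the uniform mode bound. It involves only d,
    \<eta> and \<beta>, and doubling it accounts for the tails on both sides.\<close>
  define A where "A = 1 / (2 * d * \<beta> * (1 - exp (- \<beta> * \<eta>)))"
  have q: "0 < q" "q < 1" using assms by (auto simp: q_def)
  have A: "A > 0" using assms by (simp add: A_def)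
  show ?thesis
  proof (rule exI[of _ "2 * A"], intro allI impI)
    fix \<epsilon> :: real and NT NS :: nat and t s :: "nat \<Rightarrow> real \<times> real" and M :: nat
    assume \<epsilon>: "0 < \<epsilon>" and t: "\<forall>l<NT. t l \<in> unit_cell d \<xi> \<eta>"
      and s: "\<forall>j<NS. s j \<in> unit_cell d \<xi> \<eta>" and M: "M = trunc_order d \<eta> \<epsilon>"
    let ?LDR = "L_north d \<beta> M NT t * D_north d \<xi> \<eta> \<beta> M * R_north d \<beta> M NS s"
    let ?P = "P2_north d \<xi> \<eta> \<beta> NT NS t s"
    have P: "?P \<in> carrier_mat NT NS" by (simp add: P2_north_def)
    have LDR: "?LDR \<in> carrier_mat NT NS"
      by (rule carrier_matI) (simp_all add: L_north_def R_north_def)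
    \<comment> \<open>The error matrix is the difference itself; each entry is exactly the tail of
      the mode series beyond \<open>M\<close>.\<close>
    have "cmod ((?P - ?LDR) $$ (l, j)) \<le> 2 * A * \<epsilon>" if l: "l < NT" and j: "j < NS" for l j
    proof -
      let ?a = "mode_term d \<xi> \<eta> \<beta> (t l) (s j)"
      have y: "\<bar>snd (t l) - snd (s j)\<bar> \<le> \<eta>"
        using t s l j assms by (intro unit_cell_snd_diff) auto
      have "(?a has_sum complex_of_real (K2_north d \<xi> \<eta> \<beta> (t l) (s j))) UNIV"
        using assms y by (intro K2_north_eq_mode_sum)
      moreover have "(?a has_sum (\<Sum>k\<in>{- int M..int M}. ?a k)) {- int M..int M}"
        by (intro has_sum_finite) simp
      ultimately have "(?a has_sum (complex_of_real (K2_north d \<xi> \<eta> \<beta> (t l) (s j)) - (\<Sum>k\<in>{- int M..int M}. ?a k)))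
          (UNIV - {- int M..int M})"
        by (rule has_sum_Diff) simp
      moreover have "UNIV - {- int M..int M} = {k. \<bar>k\<bar> > int M}" by auto
      moreover have "(?P - ?LDR) $$ (l, j) = complex_of_real (K2_north d \<xi> \<eta> \<beta> (t l) (s j)) - (\<Sum>k\<in>{- int M..int M}. ?a k)"
        using l j LDR by (subst index_minus_mat) (auto simp: LDR_entry P2_north_def simp del: index_mult_mat(1))
      ultimately have 1: "(?a has_sum (?P - ?LDR) $$ (l, j)) {k. \<bar>k\<bar> > int M}" by simp
      have "((\<lambda>k. A * q ^ nat \<bar>k\<bar>) has_sum (A * (2 * q ^ Suc M / (1 - q)))) {k. \<bar>k\<bar> > int M}"
        using q by (intro has_sum_cmult_right has_sum_geometric_abs_tail) auto
      from norm_infsum_le[OF 1 this] have "cmod ((?P - ?LDR) $$ (l, j)) \<le> A * (2 * q ^ Suc M / (1 - q))"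
        using norm_mode_term_le[OF assms(1,4,2) y] by (simp add: A_def q_def)
      \<comment> \<open>The tail begins at \<open>M + 1\<close>, one power more than the choice of
        \<open>M\<close> accounts for; the surplus factor \<open>q\<close> is then bounded by
        1.\<close>
      also have "\<dots> = 2 * A * q * (q ^ M / (1 - q))" by simp
      also have "\<dots> \<le> 2 * A * q * \<epsilon>"
        using trunc_order_tail[OF assms(1,2) \<epsilon>] q A
        by (intro mult_left_mono) (auto simp: M q_def field_simps)
      also have "\<dots> \<le> 2 * A * 1 * \<epsilon>"
        using q A \<epsilon> by (intro mult_right_mono mult_left_mono) auto
      finally show ?thesis by simp
    qed
    moreover have "?P = ?LDR + (?P - ?LDR)"
      using P LDR by (intro eq_matI) (auto simp del: index_mult_mat(1))
    moreover have "?P - ?LDR \<in> carrier_mat NT NS" by (rule minus_carrier_mat[OF LDR])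
    ultimately show "\<exists>E \<in> carrier_mat NT NS. (\<forall>l<NT. \<forall>j<NS. cmod (E $$ (l, j)) \<le> 2 * A * \<epsilon>) \<and> ?P = ?LDR + E"
      by blast
  qed
qed

end
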